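(* Let $P$ be the pseudoarc, identified with ${\rm pr}[\mathbb P]=\mathbb P/R^{\mathbb P}$, the natural quotient of the projective Fraïssé limit $\mathbb P$ of the class of finite linear graphs, and regard ${\rm Aut}(\mathbb P)$ as a subgroup of ${\rm Homeo}(P)$. There exists a homeomorphism $\sigma\in{\rm Homeo}(P)$ that is not conjugate in ${\rm Homeo}(P)$ to any $\tau\in{\rm Aut}(\mathbb P)$.
   Context: $\mathcal P$: the category of finite reflexive linear graphs (structures isomorphic to $\{0,\dots,n\}$ with $xRy\iff|x-y|\le1$) with morphisms ${\rm Epi}(A,B)$ all epimorphisms (maps preserving $R$ such that each $R$-related pair in $B$ is the image of an $R$-related pair in $A$). $\mathbb P=\varprojlim(A_n,\pi_n)$ for a generic sequence ($A_n\in\mathcal P$, $\pi_n\in{\rm Epi}(A_{n+1},A_n)$, every $A\in\mathcal P$ receives an epimorphism from some $A_m$, every $f\in{\rm Epi}(A,A_m)$ satisfies $f\circ g=\pi_m\circ\cdots\circ\pi_{n-1}$ for some $n>m$, $g\in{\rm Epi}(A_n,A)$), ${\rm Epi}(\mathbb P,A)=\{f\circ\pi^\infty_n:f\in{\rm Epi}(A_n,A)\}$. $xR^{\mathbb P}y$ iff $\varphi(x)R\varphi(y)$ for all such $\varphi$; this is an equivalence relation and $P=\mathbb P/R^{\mathbb P}$ (quotient map ${\rm pr}$) is the pseudoarc. ${\rm Aut}(\mathbb P)$: homeomorphisms $\sigma$ of $\mathbb P$ with $\varphi\circ\sigma,\varphi\circ\sigma^{-1}\in{\rm Epi}(\mathbb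 P,A)$ for all $\varphi\in{\rm Epi}(\mathbb P,A)$; each induces ${\rm pr}(\sigma)\in{\rm Homeo}(P)$ via ${\rm pr}(\sigma)({\rm pr}(x))={\rm pr}(\sigma(x))$, and ${\rm pr}$ is an injective homomorphism, by which ${\rm Aut}(\mathbb P)$ is identified with a subgroup of ${\rm Homeo}(P)$. *)

theory Defs
  imports "HOL-Analysis.Analysis" "HOL-Algebra.Bij"
begin

section \<open>Finite reflexive linear graphs and their epimorphisms\<close>

record 'a graph = "'a partial_object" +
  adj :: "('a \<times> 'a) set"

definition linear_graph :: "'a graph \<Rightarrow> bool" where
  "linear_graph G \<longleftrightarrow> (\<exists>(n::nat) f. bij_betw f {0..n} (carrier G) \<and>
     adj G = {(f i, f j) |i j. i \<in> {0..n} \<and> j \<in> {0..n} \<and> \<bar>int i - int j\<bar> \<le> 1})"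

text \<open>Morphisms are extensional functions, so that two of them are equal iff they agree on the
  domain of the graph. Since linear graphs are reflexive, epimorphisms are automatically onto.\<close>

definition Epi :: "'a graph \<Rightarrow> 'b graph \<Rightarrow> ('a \<Rightarrow> 'b) set" where
  "Epi G H = {f \<in> carrier G \<rightarrow>\<^sub>E carrier H.
     (\<forall>x y. (x, y) \<in> adj G \<longrightarrow> (f x, f y) \<in> adj H) \<and>
     (\<forall>u v. (u, v) \<in> adj H \<longrightarrow> (\<exists>x y. (x, y) \<in> adj G \<and> f x = u \<and> f y = v))}"

section \<open>Generic sequences and the projective Fraisse limit\<close>

text \<open>The map \<open>bond p m k\<close> is the composition of \<open>p m, \<dots>, p (m + k - 1)\<close>,
  leading from level \<open>m + k\<close> to level \<open>m\<close>.\<close>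

primrec bond :: "(nat \<Rightarrow> 'a \<Rightarrow> 'a) \<Rightarrow> nat \<Rightarrow> nat \<Rightarrow> 'a \<Rightarrow> 'a" where
  "bond p m 0 = id"
| "bond p m (Suc k) = bond p m k \<circ> p (m + k)"

text \<open>Every finite linear graph is isomorphic to one whose points are natural numbers, so the
  members of the class are represented, without loss of generality, by \<open>nat graph\<close>.\<close>

definition generic_sequence :: "(nat \<Rightarrow> nat graph) \<Rightarrow> (nat \<Rightarrow> nat \<Rightarrow> nat) \<Rightarrow> bool" where
  "generic_sequence A p \<longleftrightarrow>
     (\<forall>n. linear_graph (A n)) \<and>
     (\<forall>n. p n \<in> Epi (A (Suc n)) (A n)) \<and>
     (\<forall>B :: nat graph. linear_graph B \<longrightarrow> (\<exists>m. Epi (A m) B \<noteq> {})) \<and>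
     (\<forall>(B :: nat graph) m. \<forall>f \<in> Epi B (A m). linear_graph B \<longrightarrow>
        (\<exists>n>m. \<exists>g \<in> Epi (A n) B.
           compose (carrier (A n)) f g = restrict (bond p m (n - m)) (carrier (A n))))"

definition inv_limit :: "(nat \<Rightarrow> nat graph) \<Rightarrow> (nat \<Rightarrow> nat \<Rightarrow> nat) \<Rightarrow> (nat \<Rightarrow> nat) set" where
  "inv_limit A p = {x. \<forall>n. x n \<in> carrier (A n) \<and> p n (x (Suc n)) = x n}"

definition inv_limit_topology ::
    "(nat \<Rightarrow> nat graph) \<Rightarrow> (nat \<Rightarrow> nat \<Rightarrow> nat) \<Rightarrow> (nat \<Rightarrow> nat) topology" where
  "inv_limit_topology A p =
     subtopology (product_topology (\<lambda>n. discrete_topology (carrier (A n))) UNIV) (inv_limit A p)"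

definition limit_Epi ::
    "(nat \<Rightarrow> nat graph) \<Rightarrow> (nat \<Rightarrow> nat \<Rightarrow> nat) \<Rightarrow> nat graph \<Rightarrow> ((nat \<Rightarrow> nat) \<Rightarrow> nat) set" where
  "limit_Epi A p B = {compose (inv_limit A p) f (\<lambda>x. x n) |f n. f \<in> Epi (A n) B}"

definition limit_adj ::
    "(nat \<Rightarrow> nat graph) \<Rightarrow> (nat \<Rightarrow> nat \<Rightarrow> nat) \<Rightarrow> ((nat \<Rightarrow> nat) \<times> (nat \<Rightarrow> nat)) set" where
  "limit_adj A p = {(x, y). x \<in> inv_limit A p \<and> y \<in> inv_limit A p \<and>
     (\<forall>B. linear_graph B \<longrightarrow> (\<forall>\<phi> \<in> limit_Epi A p B. (\<phi> x, \<phi> y) \<in> adj B))}"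

section \<open>The pseudoarc\<close>

definition pr :: "(nat \<Rightarrow> nat graph) \<Rightarrow> (nat \<Rightarrow> nat \<Rightarrow> nat) \<Rightarrow> (nat \<Rightarrow> nat) \<Rightarrow> (nat \<Rightarrow> nat) set" where
  "pr A p x = limit_adj A p `` {x}"

text \<open>The quotient topology on the set of fibres \<open>q ` topspace X\<close> of a map \<open>q\<close>; the lemma
  \<open>quotient_map_quotient_topology\<close> characterises it by the library notion.\<close>

definition quotient_topology :: "'a topology \<Rightarrow> ('a \<Rightarrow> 'b) \<Rightarrow> 'b topology" where
  "quotient_topology X q =
     topology (\<lambda>U. U \<subseteq> q ` topspace X \<and> openin X {x \<in> topspace X. q x \<in> U})"

lemma openin_quotient_topology:
  "openin (quotient_topology X q) U \<longleftrightarrow>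
     U \<subseteq> q ` topspace X \<and> openin X {x \<in> topspace X. q x \<in> U}"
proof -
  let ?L = "\<lambda>U. U \<subseteq> q ` topspace X \<and> openin X {x \<in> topspace X. q x \<in> U}"
  have "istopology ?L"
    unfolding istopology_def
  proof (intro conjI allI impI)
    fix S T
    assume S: "?L S" and T: "?L T"
    have "{x \<in> topspace X. q x \<in> S \<inter> T} =
        {x \<in> topspace X. q x \<in> S} \<inter> {x \<in> topspace X. q x \<in> T}" by auto
    with S T show "openin X {x \<in> topspace X. q x \<in> S \<inter> T}" by (simp add: openin_Int)
    from S show "S \<inter> T \<subseteq> q ` topspace X" by blast
  next
    fix K
    assume K: "\<forall>U\<in>K. ?L U"
    have "{x \<in> topspace X. q x \<in> \<Union>K} = \<Union>((\<lambda>U. {x \<in> topspace X. q x \<in> U}) ` K)" by auto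
    with K show "openin X {x \<in> topspace X. q x \<in> \<Union>K}" by (metis (no_types, lifting) imageE openin_Union)
    from K show "\<Union>K \<subseteq> q ` topspace X" by blast
  qed
  then show ?thesis
    by (simp add: quotient_topology_def topology_inverse')
qed

lemma topspace_quotient_topology: "topspace (quotient_topology X q) = q ` topspace X"
proof
  show "topspace (quotient_topology X q) \<subseteq> q ` topspace X"
    by (meson openin_quotient_topology openin_topspace)
  have "{x \<in> topspace X. q x \<in> q ` topspace X} = topspace X" by auto
  then show "q ` topspace X \<subseteq> topspace (quotient_topology X q)"
    by (intro openin_subset) (simp add: openin_quotient_topology)
qed

lemma quotient_map_quotient_topology: "quotient_map X (quotient_topology X q) q"
  by (simp add: quotient_map_def topspace_quotient_topology openin_quotient_topology)

definition pseudoarc ::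
    "(nat \<Rightarrow> nat graph) \<Rightarrow> (nat \<Rightarrow> nat \<Rightarrow> nat) \<Rightarrow> (nat \<Rightarrow> nat) set topology" where
  "pseudoarc A p = quotient_topology (inv_limit_topology A p) (pr A p)"

section \<open>Homeomorphism groups and conjugacy\<close>

definition Homeo :: "'a topology \<Rightarrow> ('a \<Rightarrow> 'a) monoid" where
  "Homeo X = (BijGroup (topspace X))
     \<lparr>carrier := {f \<in> extensional (topspace X). homeomorphic_map X X f}\<rparr>"

lemma subgroup_Homeo: "subgroup (carrier (Homeo X)) (BijGroup (topspace X))"
proof -
  interpret group "BijGroup (topspace X)" by (rule group_BijGroup)
  let ?S = "topspace X"
  have Bij: "f \<in> Bij ?S" if "f \<in> carrier (Homeo X)" for f
    using that by (auto simp: Homeo_def Bij_def bij_betw_def homeomorphic_map_def quotient_map_def)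
  show ?thesis
  proof
    show "carrier (Homeo X) \<subseteq> carrier (BijGroup ?S)"
      using Bij by (auto simp: BijGroup_def)
  next
    fix f g
    assume f: "f \<in> carrier (Homeo X)" and g: "g \<in> carrier (Homeo X)"
    have "homeomorphic_map X X (f \<circ> g)"
      using f g by (auto simp: Homeo_def intro: homeomorphic_map_compose)
    then have "homeomorphic_map X X (compose ?S f g)"
      by (rule homeomorphic_map_eq) (simp add: compose_def)
    then show "f \<otimes>\<^bsub>BijGroup ?S\<^esub> g \<in> carrier (Homeo X)"
      using Bij[OF f] Bij[OF g] by (simp add: BijGroup_def Homeo_def)
  next
    have "homeomorphic_map X X (\<lambda>x\<in>?S. x)"
      by (rule homeomorphic_map_eq[of X X id]) simp_all
    then show "\<one>\<^bsub>BijGroup ?S\<^esub> \<in> carrier (Homeo X)"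
      by (simp add: BijGroup_def Homeo_def)
  next
    fix f
    assume f: "f \<in> carrier (Homeo X)"
    then obtain g where g: "homeomorphic_maps X X f g"
      by (auto simp: Homeo_def homeomorphic_map_maps)
    then have "homeomorphic_map X X g"
      using homeomorphic_map_maps homeomorphic_maps_sym by blast
    moreover have "g x = restrict (inv_into ?S f) ?S x" if "x \<in> ?S" for x
    proof -
      have "g x \<in> ?S" "f (g x) = x"
        using g that by (auto simp: homeomorphic_maps_def continuous_map_def)
      then show ?thesis
        using Bij[OF f] that by (simp add: Bij_def bij_betw_def) (metis inv_into_f_f)
    qed
    ultimately have "homeomorphic_map X X (restrict (inv_into ?S f) ?S)"
      by (rule homeomorphic_map_eq)
    then show "inv\<^bsub>BijGroup ?S\<^esub> f \<in> carrier (Homeo X)"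
      using Bij[OF f] by (simp add: inv_BijGroup Homeo_def)
  qed
qed

lemma group_Homeo: "group (Homeo X)"
  using group.subgroup_imp_group[OF group_BijGroup subgroup_Homeo[of X]]
  by (simp add: Homeo_def)

definition conjugate :: "('a, 'b) monoid_scheme \<Rightarrow> 'a \<Rightarrow> 'a \<Rightarrow> bool" where
  "conjugate G a b \<longleftrightarrow> (\<exists>h \<in> carrier G. a = h \<otimes>\<^bsub>G\<^esub> b \<otimes>\<^bsub>G\<^esub> inv\<^bsub>G\<^esub> h)"

definition Aut :: "(nat \<Rightarrow> nat graph) \<Rightarrow> (nat \<Rightarrow> nat \<Rightarrow> nat) \<Rightarrow> ((nat \<Rightarrow> nat) \<Rightarrow> nat \<Rightarrow> nat) set" where
  "Aut A p = {\<sigma> \<in> carrier (Homeo (inv_limit_topology A p)).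
     \<forall>B. linear_graph B \<longrightarrow> (\<forall>\<phi> \<in> limit_Epi A p B.
       compose (inv_limit A p) \<phi> \<sigma> \<in> limit_Epi A p B \<and>
       compose (inv_limit A p) \<phi> (inv\<^bsub>Homeo (inv_limit_topology A p)\<^esub> \<sigma>) \<in> limit_Epi A p B)}"

text \<open>The copy of \<open>Aut A p\<close> inside \<open>Homeo (pseudoarc A p)\<close>: the homeomorphisms \<open>\<tau>\<close> of the form
  \<open>pr(\<sigma>)\<close> with \<open>\<sigma>\<close> in \<open>Aut A p\<close>. As \<open>pr\<close> maps onto the pseudoarc, the equation determines
  \<open>\<tau>\<close> from \<open>\<sigma>\<close>.\<close>

definition pr_Aut ::
    "(nat \<Rightarrow> nat graph) \<Rightarrow> (nat \<Rightarrow> nat \<Rightarrow> nat) \<Rightarrow> ((nat \<Rightarrow> nat) set \<Rightarrow> (nat \<Rightarrow> nat) set) set" where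
  "pr_Aut A p = {\<tau> \<in> carrier (Homeo (pseudoarc A p)).
     \<exists>\<sigma> \<in> Aut A p. \<forall>x \<in> inv_limit A p. \<tau> (pr A p x) = pr A p (\<sigma> x)}"

end

theory Submission
  imports Defs "HOL-Library.Diagonal_Subsequence"
begin

text \<open>An element \<open>\<tau>\<close> of \<open>Aut(\<P>)\<close> acts on the Cantor set \<open>\<P>\<close>, whose fibres over the pseudoarc have at
  most two points. So \<open>\<tau>\<^sup>2\<close> fixes every point of \<open>\<P>\<close> lying over a fixed point, and by compactness it
  preserves a given clopen subset of \<open>\<P>\<close> near these points. Hence the induced homeomorphism, and each
  of its conjugates, cannot have arbitrarily slow orbit segments leading from one fixed closed set to
  a disjoint one.

  A homeomorphism \<open>\<sigma>\<close> with such orbits is obtained from paths \<open>B\<^sub>n\<close> cofinal in the generic sequence,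
  with bonding maps \<open>f\<^sub>n\<close> and further maps \<open>g\<^sub>n\<close> that approximate \<open>\<sigma>\<close> for even \<open>n\<close> and its inverse
  for odd \<open>n\<close>, such that \<open>f\<^sub>n f\<^sub>n\<^sub>+\<^sub>1\<close> and \<open>g\<^sub>n g\<^sub>n\<^sub>+\<^sub>1\<close> agree only up to adjacency. On a segment
  \<open>[a, b]\<close> of \<open>B\<^sub>n\<^sub>+\<^sub>1\<close> the map \<open>g\<^sub>n\<close> runs a little ahead of \<open>f\<^sub>n\<close> along the final part of \<open>B\<^sub>n\<close>, on
  which the previous two maps coincide; the next level traps orbits inside this segment, so that
  they drift along all of it. The remaining parts are amalgamated exactly, by the mountain climbing
  theorem.\<close>

subsection \<open>Mountain climbing\<close>

text \<open>Additive form of a bound on the distance, which avoids truncated subtraction on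
  \<open>nat\<close>.\<close>

definition near :: "nat \<Rightarrow> nat \<Rightarrow> nat \<Rightarrow> bool" where
  "near k a b \<longleftrightarrow> a \<le> b + k \<and> b \<le> a + k"

definition walk :: "nat \<Rightarrow> (nat \<Rightarrow> nat) \<Rightarrow> bool" where
  "walk n f \<longleftrightarrow> (\<forall>i<n. near 1 (f i) (f (Suc i)))"

lemma near_refl [simp]: "near k a a"
  by (simp add: near_def)

lemma near_sym: "near k a b \<Longrightarrow> near k b a"
  by (simp add: near_def)

lemma walkD: "walk n f \<Longrightarrow> i < n \<Longrightarrow> near 1 (f i) (f (Suc i))"
  by (simp add: walk_def)

text \<open>Discrete intermediate value theorem: steps of size at most 1 cannot jump over
  \<open>v\<close>.\<close>

lemma walk_attains:
  assumes "walk n f" "i \<le> j" "j \<le> n" "f i \<le> v \<and> v \<le> f j \<or> f j \<le> v \<and> v \<le> f i"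
  shows "\<exists>x. i \<le> x \<and> x \<le> j \<and> f x = v"
  using assms(2,3,4)
proof (induction j rule: dec_induct)
  case base
  then show ?case by auto
next
  case (step j)
  have nr: "near 1 (f j) (f (Suc j))" using assms(1) step by (auto simp: walk_def)
  show ?case
  proof (cases "f i \<le> v \<and> v \<le> f j \<or> f j \<le> v \<and> v \<le> f i")
    case True
    with step obtain x where "i \<le> x \<and> x \<le> j \<and> f x = v" by auto
    then show ?thesis by (auto intro!: exI[of _ x])
  next
    case False
    with nr step have "f (Suc j) = v" by (auto simp: near_def)
    with step show ?thesis by (auto intro!: exI[of _ "Suc j"])
  qed
qed

text \<open>The edges of the fibre product of two graphs over the heights \<open>F\<close> and
  \<open>G\<close>. Mountain climbing is a connectedness statement about this product.\<close>

definition level_steps ::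
    "('a \<times> 'a) set \<Rightarrow> ('b \<times> 'b) set \<Rightarrow> ('a \<Rightarrow> nat) \<Rightarrow> ('b \<Rightarrow> nat) \<Rightarrow> (('a \<times> 'b) \<times> ('a \<times> 'b)) set" where
  "level_steps RX RY F G =
     {((a, b), (a', b')). (a, a') \<in> RX \<and> (b, b') \<in> RY \<and> F a = G b \<and> F a' = G b'}"

lemma ex_argmax: "\<exists>p\<le>n::nat. \<forall>i\<le>n. h i \<le> (h p :: nat)"
proof (induction n)
  case (Suc n)
  then obtain p where "p \<le> n" "\<forall>i\<le>n. h i \<le> h p" by blast
  then show ?case
    by (intro exI[of _ "if h (Suc n) \<le> h p then p else Suc n"]) (auto simp: le_Suc_eq)
qed simp

text \<open>Induction on \<open>n + m\<close>; the relations \<open>RX\<close> and \<open>RY\<close>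
  stay fixed and symmetric so that the hypothesis applies to reversed and shifted pieces of
  \<open>x\<close> and \<open>y\<close>. If neither height returns to \<open>lo\<close>, both start
  with a step up and \<open>lo\<close> can be raised. Otherwise the last return is reached by way of
  the highest peak before it, while the other climber goes up and comes back to its start.\<close>

lemma mountain_climbing_rtrancl:
  fixes F :: "'a \<Rightarrow> nat" and G :: "'b \<Rightarrow> nat"
  assumes sym: "sym RX" "sym RY"
    and lip: "\<And>a a'. (a, a') \<in> RX \<Longrightarrow> near 1 (F a) (F a')" "\<And>b b'. (b, b') \<in> RY \<Longrightarrow> near 1 (G b) (G b')"
    and "\<And>i. i \<le> n \<Longrightarrow> (x i, x i) \<in> RX" "\<And>i. i < n \<Longrightarrow> (x i, x (Suc i)) \<in> RX"
    and "\<And>j. j \<le> m \<Longrightarrow> (y j, y j) \<in> RY" "\<And>j. j < m \<Longrightarrow> (y j, y (Suc j)) \<in> RY"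
    and "F (x 0) = lo" "G (y 0) = lo" "F (x n) = hi" "G (y m) = hi"
    and "\<And>i. i \<le> n \<Longrightarrow> lo \<le> F (x i) \<and> F (x i) \<le> hi"
    and "\<And>j. j \<le> m \<Longrightarrow> lo \<le> G (y j) \<and> G (y j) \<le> hi"
  shows "((x 0, y 0), (x n, y m)) \<in> (level_steps RX RY F G)\<^sup>*"
  using assms(5-)
proof (induction "n + m" arbitrary: n m x y lo hi rule: less_induct)
  case less
  let ?E = "level_steps RX RY F G"
  note xr = less.prems(1) and xs = less.prems(2) and yr = less.prems(3) and ys = less.prems(4)
    and x0 = less.prems(5) and y0 = less.prems(6) and xn = less.prems(7) and ym = less.prems(8)
    and xb = less.prems(9) and yb = less.prems(10)
  have symE: "(q, p) \<in> ?E\<^sup>*" if "(p, q) \<in> ?E\<^sup>*" for p q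
  proof -
    have "sym ?E" by (rule symI) (auto simp: level_steps_def dest: symD[OF sym(1)] symD[OF sym(2)])
    then show ?thesis using symD[OF sym_rtrancl that] by blast
  qed
  consider (flat) "lo = hi"
    | (x) n0 where "lo \<noteq> hi" "0 < n0" "n0 \<le> n" "F (x n0) = lo" "\<And>i. n0 < i \<Longrightarrow> i \<le> n \<Longrightarrow> F (x i) \<noteq> lo"
    | (y) m0 where "lo \<noteq> hi" "0 < m0" "m0 \<le> m" "G (y m0) = lo" "\<And>i. m0 < i \<Longrightarrow> i \<le> m \<Longrightarrow> G (y i) \<noteq> lo"
    | (step) "lo \<noteq> hi" "\<And>i. 0 < i \<Longrightarrow> i \<le> n \<Longrightarrow> F (x i) \<noteq> lo" "\<And>i. 0 < i \<Longrightarrow> i \<le> m \<Longrightarrow> G (y i) \<noteq> lo"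
  proof -
    have last: "\<exists>k. 0 < k \<and> k \<le> N \<and> P k \<and> (\<forall>i. k < i \<longrightarrow> i \<le> N \<longrightarrow> \<not> P i)"
      if "0 < k0" "k0 \<le> N" "P k0" for k0 N and P :: "nat \<Rightarrow> bool"
    proof -
      let ?k = "GREATEST k. k \<le> N \<and> P k"
      have "?k \<le> N \<and> P ?k" by (rule GreatestI_nat[of _ k0 N]) (use that in auto)
      moreover have le: "i \<le> ?k" if "i \<le> N" "P i" for i by (rule Greatest_le_nat[of _ i N]) (use that in auto)
      moreover have "\<not> P i" if "?k < i" "i \<le> N" for i using le[of i] that by linarith
      ultimately show ?thesis using that le[OF that(2,3)] by (intro exI[of _ ?k]) simp
    qed
    show ?thesis
    proof (cases "lo = hi")
      case False
      show ?thesis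
      proof (cases "\<exists>k. 0 < k \<and> k \<le> n \<and> F (x k) = lo")
        case True
        then obtain k0 where "0 < k0" "k0 \<le> n" "F (x k0) = lo" by auto
        from last[of k0 n "\<lambda>k. F (x k) = lo", OF this] obtain k where
          k: "0 < k" "k \<le> n" "F (x k) = lo" "\<forall>i. k < i \<longrightarrow> i \<le> n \<longrightarrow> F (x i) \<noteq> lo" by auto
        show ?thesis by (rule x[of k]) (use k False in auto)
      next
        case nx: False
        show ?thesis
        proof (cases "\<exists>k. 0 < k \<and> k \<le> m \<and> G (y k) = lo")
          case True
          then obtain k0 where "0 < k0" "k0 \<le> m" "G (y k0) = lo" by auto
          from last[of k0 m "\<lambda>k. G (y k) = lo", OF this] obtain k where
            k: "0 < k" "k \<le> m" "G (y k) = lo" "\<forall>i. k < i \<longrightarrow> i \<le> m \<longrightarrow> G (y i) \<noteq> lo" by auto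
          show ?thesis by (rule y[of k]) (use k False in auto)
        next
          case ny: False
          show ?thesis by (rule step) (use nx ny False in auto)
        qed
      qed
    qed (use flat in blast)
  qed
  then show ?case
  proof cases
    case flat
    have cF: "F (x i) = lo" if "i \<le> n" for i using xb[OF that] flat by simp
    have cG: "G (y i) = lo" if "i \<le> m" for i using yb[OF that] flat by simp
    have "i \<le> n \<Longrightarrow> ((x 0, y 0), (x i, y 0)) \<in> ?E\<^sup>*" for i
    proof (induction i)
      case (Suc i)
      have "((x i, y 0), (x (Suc i), y 0)) \<in> ?E"
        using Suc xs[of i] yr[of 0] cF[of i] cF[of "Suc i"] cG[of 0] by (auto simp: level_steps_def)
      then show ?case using Suc by (meson Suc_leD rtrancl.rtrancl_into_rtrancl)
    qed auto
    then have 1: "((x 0, y 0), (x n, y 0)) \<in> ?E\<^sup>*" by simp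
    have "j \<le> m \<Longrightarrow> ((x n, y 0), (x n, y j)) \<in> ?E\<^sup>*" for j
    proof (induction j)
      case (Suc j)
      have "((x n, y j), (x n, y (Suc j))) \<in> ?E"
        using Suc ys[of j] xr[of n] cG[of j] cG[of "Suc j"] cF[of n] by (auto simp: level_steps_def)
      then show ?case using Suc by (meson Suc_leD rtrancl.rtrancl_into_rtrancl)
    qed auto
    then have "((x n, y 0), (x n, y m)) \<in> ?E\<^sup>*" by simp
    with 1 show ?thesis by (rule rtrancl_trans)
  next
    case (x n0)
    have n0: "n0 < n" using x xn by (metis le_neq_implies_less)
    \<comment> \<open>\<open>p\<close> is a highest peak before the last return \<open>n0\<close>,
      and \<open>q\<close> is the first time at which \<open>y\<close> reaches that height, so
      \<open>y\<close> stays below it until then.\<close>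
    obtain p where p: "p \<le> n0" "\<And>i. i \<le> n0 \<Longrightarrow> F (x i) \<le> F (x p)"
      using ex_argmax[of n0 "\<lambda>i. F (x i)"] by blast
    let ?l = "F (x p)"
    have pb: "lo \<le> ?l" "?l \<le> hi" using xb[of p] p n0 by auto
    have wy: "walk m (\<lambda>j. G (y j))" using ys lip by (auto simp: walk_def)
    then have "\<exists>q\<le>m. G (y q) = ?l" using walk_attains[OF wy, of 0 m ?l] y0 ym pb by auto
    define q where "q = (LEAST q. G (y q) = ?l)"
    have q: "G (y q) = ?l" "q \<le> m"
      using \<open>\<exists>q\<le>m. G (y q) = ?l\<close> unfolding q_def by (auto intro: LeastI Least_le le_trans)
    have qb: "G (y j) \<le> ?l" if jq: "j \<le> q" for j
    proof (rule ccontr)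
      assume c: "\<not> G (y j) \<le> ?l"
      then have "j < q" using jq q by (metis le_neq_implies_less order_refl)
      moreover obtain i where "i \<le> j" "G (y i) = ?l"
        using walk_attains[OF wy, of 0 j ?l] c y0 pb jq q by auto
      ultimately have "i < q" by simp
      from not_less_Least[OF this[unfolded q_def]] show False using \<open>G (y i) = ?l\<close> by simp
    qed
    have 1: "((x 0, y 0), (x p, y q)) \<in> ?E\<^sup>*"
      by (rule less.hyps[of p q x y lo ?l])
        (use p q n0 xr xs yr ys x0 y0 xb yb qb in auto)
    \<comment> \<open>The way down from the peak to \<open>n0\<close> is a climb when read
      backwards. Reversing the resulting path brings \<open>y\<close> back to its start while
      \<open>x\<close> arrives at \<open>n0\<close>.\<close>
    have 2: "((x (n0 - 0), y 0), (x (n0 - (n0 - p)), y q)) \<in> ?E\<^sup>*"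
    proof (rule less.hyps[of "n0 - p" q "\<lambda>i. x (n0 - i)" y lo ?l])
      show "n0 - p + q < n + m" using n0 q by auto
      show "(x (n0 - i), x (n0 - Suc i)) \<in> RX" if "i < n0 - p" for i
      proof -
        have "Suc (n0 - Suc i) = n0 - i" using that by simp
        then have "(x (n0 - Suc i), x (n0 - i)) \<in> RX" using xs[of "n0 - Suc i"] n0 that by simp
        then show ?thesis using sym by (meson symD)
      qed
    qed (use p q n0 xr xs yr ys x0 y0 xb yb qb x in auto)
    \<comment> \<open>The remaining climb is shorter because \<open>0 < n0\<close>.\<close>
    have 3: "((x (n0 + 0), y 0), (x (n0 + (n - n0)), y m)) \<in> ?E\<^sup>*"
      by (rule less.hyps[of "n - n0" m "\<lambda>i. x (n0 + i)" y lo hi])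
        (use n0 xr xs yr ys x0 y0 xn ym xb yb x in auto)
    have "((x p, y q), (x n0, y 0)) \<in> ?E\<^sup>*" using symE[OF 2] p by simp
    from rtrancl_trans[OF rtrancl_trans[OF 1 this]] 3 n0 show ?thesis by simp
  next
    case (y m0)
    \<comment> \<open>The previous case with the roles of the two sequences exchanged.\<close>
    have m0: "m0 < m" using y ym by (metis le_neq_implies_less)
    obtain p where p: "p \<le> m0" "\<And>i. i \<le> m0 \<Longrightarrow> G (y i) \<le> G (y p)"
      using ex_argmax[of m0 "\<lambda>i. G (y i)"] by blast
    let ?l = "G (y p)"
    have pb: "lo \<le> ?l" "?l \<le> hi" using yb[of p] p m0 by auto
    have wx: "walk n (\<lambda>j. F (x j))" using xs lip by (auto simp: walk_def)
    then have "\<exists>q\<le>n. F (x q) = ?l" using walk_attains[OF wx, of 0 n ?l] x0 xn pb by auto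
    define q where "q = (LEAST q. F (x q) = ?l)"
    have q: "F (x q) = ?l" "q \<le> n"
      using \<open>\<exists>q\<le>n. F (x q) = ?l\<close> unfolding q_def by (auto intro: LeastI Least_le le_trans)
    have qb: "F (x j) \<le> ?l" if jq: "j \<le> q" for j
    proof (rule ccontr)
      assume c: "\<not> F (x j) \<le> ?l"
      then have "j < q" using jq q by (metis le_neq_implies_less order_refl)
      moreover obtain i where "i \<le> j" "F (x i) = ?l"
        using walk_attains[OF wx, of 0 j ?l] c x0 pb jq q by auto
      ultimately have "i < q" by simp
      from not_less_Least[OF this[unfolded q_def]] show False using \<open>F (x i) = ?l\<close> by simp
    qed
    have 1: "((x 0, y 0), (x q, y p)) \<in> ?E\<^sup>*"
      by (rule less.hyps[of q p x y lo ?l])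
        (use p q m0 xr xs yr ys x0 y0 xb yb qb in auto)
    have 2: "((x 0, y (m0 - 0)), (x q, y (m0 - (m0 - p)))) \<in> ?E\<^sup>*"
    proof (rule less.hyps[of q "m0 - p" x "\<lambda>i. y (m0 - i)" lo ?l])
      show "q + (m0 - p) < n + m" using m0 q by auto
      show "(y (m0 - i), y (m0 - Suc i)) \<in> RY" if "i < m0 - p" for i
      proof -
        have "Suc (m0 - Suc i) = m0 - i" using that by simp
        then have "(y (m0 - Suc i), y (m0 - i)) \<in> RY" using ys[of "m0 - Suc i"] m0 that by simp
        then show ?thesis using sym by (meson symD)
      qed
    qed (use p q m0 xr xs yr ys x0 y0 xb yb qb y in auto)
    have 3: "((x 0, y (m0 + 0)), (x n, y (m0 + (m - m0)))) \<in> ?E\<^sup>*"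
      by (rule less.hyps[of n "m - m0" x "\<lambda>i. y (m0 + i)" lo hi])
        (use m0 xr xs yr ys x0 y0 xn ym xb yb y in auto)
    have "((x q, y p), (x 0, y m0)) \<in> ?E\<^sup>*" using symE[OF 2] p by simp
    from rtrancl_trans[OF rtrancl_trans[OF 1 this]] 3 m0 show ?thesis by simp
  next
    case step
    have n: "0 < n" using x0 xn step by (metis gr0I)
    have m: "0 < m" using y0 ym step by (metis gr0I)
    have x1: "F (x (Suc 0)) = Suc lo"
      using lip(1)[OF xs[OF n]] step(2)[of "Suc 0"] n x0 xb[of "Suc 0"] by (auto simp: near_def)
    have y1: "G (y (Suc 0)) = Suc lo"
      using lip(2)[OF ys[OF m]] step(3)[of "Suc 0"] m y0 yb[of "Suc 0"] by (auto simp: near_def)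
    have 1: "((x 0, y 0), (x (Suc 0), y (Suc 0))) \<in> ?E"
      using xs[OF n] ys[OF m] x0 y0 x1 y1 by (auto simp: level_steps_def)
    have "((x (Suc 0), y (Suc 0)), (x (Suc (n - 1)), y (Suc (m - 1)))) \<in> ?E\<^sup>*"
    proof (rule less.hyps[of "n - 1" "m - 1" "\<lambda>i. x (Suc i)" "\<lambda>i. y (Suc i)" "Suc lo" hi])
      show "Suc lo \<le> F (x (Suc i)) \<and> F (x (Suc i)) \<le> hi" if "i \<le> n - 1" for i
        using xb[of "Suc i"] step(2)[of "Suc i"] that n by linarith
      show "Suc lo \<le> G (y (Suc i)) \<and> G (y (Suc i)) \<le> hi" if "i \<le> m - 1" for i
        using yb[of "Suc i"] step(3)[of "Suc i"] that m by linarith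
    qed (use n m xr xs yr ys x1 y1 xn ym in auto)
    with 1 n m show ?thesis by simp
  qed
qed

lemma mountain_climbing:
  assumes f: "walk n f" "f 0 = lo" "f n = hi" "\<And>i. i \<le> n \<Longrightarrow> lo \<le> f i \<and> f i \<le> hi"
    and g: "walk m g" "g 0 = lo" "g m = hi" "\<And>i. i \<le> m \<Longrightarrow> lo \<le> g i \<and> g i \<le> hi"
  obtains L u v where "walk L u" "walk L v" "u 0 = 0" "v 0 = 0" "u L = n" "v L = m"
    "\<And>i. i \<le> L \<Longrightarrow> u i \<le> n" "\<And>i. i \<le> L \<Longrightarrow> v i \<le> m" "\<And>i. i \<le> L \<Longrightarrow> f (u i) = g (v i)"
proof -
  \<comment> \<open>Adjacent indices with adjacent heights: this is symmetric, contains the steps of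
    a walk, and carries the Lipschitz bound in its definition.\<close>
  define S where "S N h = {(i, j). i \<le> N \<and> j \<le> N \<and> near 1 i j \<and> near 1 (h i) (h j)}"
    for N and h :: "nat \<Rightarrow> nat"
  let ?E = "level_steps (S n f) (S m g) f g"
  have symS: "sym (S N h)" for N h by (auto simp: S_def sym_def near_def)
  have SI: "(i, Suc i) \<in> S N h" if "walk N h" "i < N" for i N h
    using that walkD[OF that] by (simp add: S_def) (simp add: near_def)
  have "((id 0, id 0), (id n, id m)) \<in> ?E\<^sup>*"
  proof (rule mountain_climbing_rtrancl[OF symS symS, where lo = lo and hi = hi])
    show "near 1 (f a) (f a')" if "(a, a') \<in> S n f" for a a' using that by (simp add: S_def)
    show "near 1 (g a) (g a')" if "(a, a') \<in> S m g" for a a' using that by (simp add: S_def)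
    show "(id i, id (Suc i)) \<in> S n f" if "i < n" for i using SI[OF f(1) that] by simp
    show "(id i, id (Suc i)) \<in> S m g" if "i < m" for i using SI[OF g(1) that] by simp
  qed (use f g in \<open>auto simp: S_def\<close>)
  then obtain L where "((0, 0), (n, m)) \<in> ?E ^^ L" by (auto dest: rtrancl_imp_relpow)
  then obtain q where q: "q 0 = (0, 0)" "q L = (n, m)" "\<And>i. i < L \<Longrightarrow> (q i, q (Suc i)) \<in> ?E"
    by (auto simp: relpow_fun_conv)
  have st: "near 1 (fst (q i)) (fst (q (Suc i)))" "near 1 (snd (q i)) (snd (q (Suc i)))"
     "fst (q i) \<le> n" "snd (q i) \<le> m" "f (fst (q i)) = g (snd (q i))" if "i < L" for i
    using q(3)[OF that] by (auto simp: level_steps_def S_def split: prod.splits)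
  have "fst (q i) \<le> n \<and> snd (q i) \<le> m \<and> f (fst (q i)) = g (snd (q i))" if "i \<le> L" for i
    using st[of i] q(2) f(3) g(3) that by (cases "i = L") auto
  then show ?thesis
    by (intro that[of L "\<lambda>i. fst (q i)" "\<lambda>i. snd (q i)"]) (use q st in \<open>auto simp: walk_def\<close>)
qed

text \<open>Reflecting the heights at \<open>hi\<close> turns descents into climbs.\<close>

lemma mountain_descending:
  assumes f: "walk n f" "f 0 = hi" "f n = lo" "\<And>i. i \<le> n \<Longrightarrow> lo \<le> f i \<and> f i \<le> hi"
    and g: "walk m g" "g 0 = hi" "g m = lo" "\<And>i. i \<le> m \<Longrightarrow> lo \<le> g i \<and> g i \<le> hi"
  obtains L u v where "walk L u" "walk L v" "u 0 = 0" "v 0 = 0" "u L = n" "v L = m"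
    "\<And>i. i \<le> L \<Longrightarrow> u i \<le> n" "\<And>i. i \<le> L \<Longrightarrow> v i \<le> m" "\<And>i. i \<le> L \<Longrightarrow> f (u i) = g (v i)"
proof -
  have w: "walk k (\<lambda>i. hi - h i)" if "walk k h" for k h
  proof -
    have *: "near 1 (hi - a) (hi - b)" if "near 1 a b" for a b
      using that unfolding near_def by linarith
    show ?thesis unfolding walk_def by (intro allI impI * walkD[OF that])
  qed
  obtain L u v where *: "walk L u" "walk L v" "u 0 = 0" "v 0 = 0" "u L = n" "v L = m"
    "\<And>i. i \<le> L \<Longrightarrow> u i \<le> n" "\<And>i. i \<le> L \<Longrightarrow> v i \<le> m" "\<And>i. i \<le> L \<Longrightarrow> hi - f (u i) = hi - g (v i)"
    by (rule mountain_climbing[OF w[OF f(1)] _ _ _ w[OF g(1)], where lo = 0 and hi = "hi - lo"])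
      (use f g in \<open>auto intro: diff_le_mono2\<close>)
  have "f (u i) = g (v i)" if "i \<le> L" for i
    using *(7-9)[OF that] f(4)[of "u i"] g(4)[of "v i"] by linarith
  with * show ?thesis using that by blast
qed

subsection \<open>One step of the construction\<close>

text \<open>The constant \<open>5\<close> is the total error \<open>2 + 1 + 2\<close> in
  \<open>\<Sigma>_near\<close>, which one such map has to reduce to adjacency.\<close>

definition contracting :: "nat \<Rightarrow> (nat \<Rightarrow> nat) \<Rightarrow> bool" where
  "contracting N f \<longleftrightarrow> (\<forall>x\<le>N. \<forall>y\<le>N. near 5 x y \<longrightarrow> near 1 (f x) (f y))"

text \<open>The maps \<open>f, g\<close> climb from \<open>0\<close> to the top \<open>M\<close> on \<open>[0, a]\<close>, descend to \<open>t\<close> on \<open>[a, b]\<close> and coincide on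
  \<open>[b, N]\<close>. The three extremal points allow each segment to be amalgamated separately.\<close>

definition zigzag :: "nat \<Rightarrow> nat \<Rightarrow> nat \<Rightarrow> nat \<Rightarrow> nat \<Rightarrow> (nat \<Rightarrow> nat) \<Rightarrow> (nat \<Rightarrow> nat) \<Rightarrow> bool" where
  "zigzag N a b M t f g \<longleftrightarrow>
     a \<le> b \<and> b \<le> N \<and> contracting N f \<and> contracting N g \<and>
     (\<forall>x\<le>N. f x \<le> M \<and> g x \<le> M) \<and>
     f 0 = 0 \<and> g 0 = 0 \<and> f a = M \<and> g a = M \<and> f b = t \<and> g b = t \<and> f N = M \<and> g N = M \<and>
     (\<forall>x. a \<le> x \<and> x \<le> b \<longrightarrow> t \<le> f x \<and> t \<le> g x) \<and>
     (\<forall>x. b \<le> x \<and> x \<le> N \<longrightarrow> f x = g x \<and> t \<le> f x)"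

text \<open>On the way down from \<open>M\<close> to \<open>t\<close>, \<open>f\<close> lags
  \<open>2\<close> behind \<open>g\<close>. This exceeds the error \<open>1\<close> made in
  \<open>drift_step\<close>, so a positive displacement remains. The exceptions are the cap at
  \<open>M\<close> and the arrival at \<open>t\<close>.\<close>

definition drift :: "nat \<Rightarrow> nat \<Rightarrow> nat \<Rightarrow> nat \<Rightarrow> (nat \<Rightarrow> nat) \<Rightarrow> (nat \<Rightarrow> nat) \<Rightarrow> bool" where
  "drift a b M t f g \<longleftrightarrow>
     (\<forall>x. a \<le> x \<and> x \<le> b \<longrightarrow> g x \<le> f x \<and> f x \<le> g x + 2 \<and> (t < g x \<longrightarrow> f x = min M (g x + 2)))"

text \<open>The locality condition on \<open>(a, b)\<close> is what traps orbits in the drift segment of the previous level.\<close>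

definition linked ::
    "nat \<Rightarrow> nat \<Rightarrow> (nat \<Rightarrow> nat) \<Rightarrow> (nat \<Rightarrow> nat) \<Rightarrow> nat \<Rightarrow> (nat \<Rightarrow> nat) \<Rightarrow> (nat \<Rightarrow> nat) \<Rightarrow> bool" where
  "linked a b f g N' f' g' \<longleftrightarrow>
     (\<forall>x\<le>N'. near 1 (f (f' x)) (g (g' x)) \<and>
       (a < f' x \<and> f' x < b \<longrightarrow> a \<le> g' x \<and> g' x \<le> b \<and> f (f' x) = g (g' x)))"

section \<open>Elementary operations on walks\<close>

lemma walk_near:
  assumes "walk n f" "i \<le> n" "j \<le> n" "near 1 i j"
  shows "near 1 (f i) (f j)"
proof -
  consider "i = j" | "j = Suc i" | "i = Suc j" using assms(4) unfolding near_def by linarith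
  then show ?thesis
    by cases (use assms walkD[OF assms(1)] near_sym in auto)
qed

lemma contractingD: "contracting N f \<Longrightarrow> x \<le> N \<Longrightarrow> y \<le> N \<Longrightarrow> near 5 x y \<Longrightarrow> near 1 (f x) (f y)"
  unfolding contracting_def by blast

lemma contracting_walk:
  assumes "contracting N f"
  shows "walk N f"
  unfolding walk_def
proof (intro allI impI)
  fix i assume "i < N"
  then show "near 1 (f i) (f (Suc i))"
    by (intro contractingD[OF assms]) (auto simp: near_def)
qed

lemma walk_comp:
  assumes "walk n f" "walk m g" "\<And>i. i \<le> m \<Longrightarrow> g i \<le> n"
  shows "walk m (\<lambda>i. f (g i))"
  unfolding walk_def
proof (intro allI impI)
  fix i assume "i < m"
  then show "near 1 (f (g i)) (f (g (Suc i)))"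
    by (intro walk_near[OF assms(1)] assms(3) walkD[OF assms(2)]) auto
qed

lemma walk_shift: "walk n f \<Longrightarrow> a + m \<le> n \<Longrightarrow> walk m (\<lambda>i. f (a + i))"
  unfolding walk_def[of m] by (intro allI impI) (drule walkD[of n f "a + _"], simp_all)

lemma walk_rev:
  assumes "walk n f"
  shows "walk n (\<lambda>i. f (n - i))"
  unfolding walk_def
proof (intro allI impI)
  fix i assume "i < n"
  then have "near 1 (n - i) (n - Suc i)" unfolding near_def by linarith
  then show "near 1 (f (n - i)) (f (n - Suc i))" by (intro walk_near[OF assms]) auto
qed

lemma walk_offset: "walk n f \<Longrightarrow> walk n (\<lambda>i. c + f i)"
  by (simp add: walk_def near_def)

text \<open>Concatenation with a shared junction: index \<open>n\<close> is both the end of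
  \<open>w\<close> and the place of \<open>w' 0\<close>, and \<open>walk_cat\<close> and
  \<open>cat_right\<close> ask that the two values agree.\<close>

definition cat :: "nat \<Rightarrow> (nat \<Rightarrow> 'a) \<Rightarrow> (nat \<Rightarrow> 'a) \<Rightarrow> nat \<Rightarrow> 'a" where
  "cat n w w' i = (if i \<le> n then w i else w' (i - n))"

lemma cat_left: "i \<le> n \<Longrightarrow> cat n w w' i = w i"
  by (simp add: cat_def)

lemma cat_right: "n \<le> i \<Longrightarrow> w n = w' 0 \<Longrightarrow> cat n w w' i = w' (i - n)"
  by (simp add: cat_def)

lemma walk_cat:
  assumes "walk n w" "walk m w'" "w n = w' 0"
  shows "walk (n + m) (cat n w w')"
  unfolding walk_def
proof (intro allI impI)
  fix i assume i: "i < n + m"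
  show "near 1 (cat n w w' i) (cat n w w' (Suc i))"
  proof (cases "i < n")
    case True
    then show ?thesis using walkD[OF assms(1), of i] by (simp add: cat_left)
  next
    case False
    then have "Suc i - n = Suc (i - n)" "i - n < m" using i by auto
    then show ?thesis using walkD[OF assms(2), of "i - n"] assms(3) False by (simp add: cat_right)
  qed
qed

lemma cat_all2:
  assumes "\<And>i. i \<le> n \<Longrightarrow> P (w i) (z i)" "\<And>i. i \<le> m \<Longrightarrow> P (w' i) (z' i)" "i \<le> n + m"
  shows "P (cat n w w' i) (cat n z z' i)"
  using assms by (cases "i \<le> n") (auto simp: cat_def)

text \<open>The segments \<open>[0, a]\<close>, \<open>[a, b]\<close> and \<open>[b, N]\<close> are
  amalgamated separately and the results concatenated. The middle segment is paired only with
  itself, which gives the locality condition.\<close>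

lemma zigzag_climb:
  assumes z: "zigzag N a b M t f g"
  obtains L u v where "walk L u" "walk L v" "u 0 = 0" "v 0 = 0" "u L = N" "v L = N"
    "\<And>i. i \<le> L \<Longrightarrow> u i \<le> N" "\<And>i. i \<le> L \<Longrightarrow> v i \<le> N"
    "\<And>i. i \<le> L \<Longrightarrow> f (u i) = g (v i) \<and> (a < u i \<and> u i < b \<longrightarrow> a \<le> v i \<and> v i \<le> b)"
proof -
  note z' = z[unfolded zigzag_def]
  have ab: "a \<le> b" "b \<le> N" using z' by auto
  have wf: "walk N f" and wg: "walk N g" using z' by (auto intro: contracting_walk)
  have wa: "walk a f" "walk a g" using walk_shift[OF wf, of 0 a] walk_shift[OF wg, of 0 a] ab by auto
  have bd: "0 \<le> f i \<and> f i \<le> M" "0 \<le> g i \<and> g i \<le> M" if "i \<le> N" for i using z' that by auto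
  have ba: "0 \<le> f i \<and> f i \<le> M" "0 \<le> g i \<and> g i \<le> M" if "i \<le> a" for i using bd that ab by auto
  have ends: "f 0 = 0" "g 0 = 0" "f a = M" "g a = M" "f b = t" "g b = t" using z' by auto
  obtain L1 u1 v1 where 1: "walk L1 u1" "walk L1 v1" "u1 0 = 0" "v1 0 = 0" "u1 L1 = a" "v1 L1 = a"
    "\<And>i. i \<le> L1 \<Longrightarrow> u1 i \<le> a" "\<And>i. i \<le> L1 \<Longrightarrow> v1 i \<le> a" "\<And>i. i \<le> L1 \<Longrightarrow> f (u1 i) = g (v1 i)"
    using mountain_climbing[OF wa(1) ends(1,3) ba(1) wa(2) ends(2,4) ba(2)] by metis
  define n where "n = b - a"
  have an: "a + n = b" using ab n_def by simp
  have wb: "walk n (\<lambda>i. f (a + i))" "walk n (\<lambda>i. g (a + i))"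
    using walk_shift[OF wf, of a n] walk_shift[OF wg, of a n] ab an by auto
  have bb: "t \<le> f (a + i) \<and> f (a + i) \<le> M" "t \<le> g (a + i) \<and> g (a + i) \<le> M" if "i \<le> n" for i
  proof -
    have "a \<le> a + i" "a + i \<le> b" "a + i \<le> N" using that an ab by auto
    then show "t \<le> f (a + i) \<and> f (a + i) \<le> M" "t \<le> g (a + i) \<and> g (a + i) \<le> M"
      using z' by blast+
  qed
  have eb: "f (a + 0) = M" "g (a + 0) = M" "f (a + n) = t" "g (a + n) = t" using ends an by auto
  obtain L2 u2 v2 where 2: "walk L2 u2" "walk L2 v2" "u2 0 = 0" "v2 0 = 0" "u2 L2 = n" "v2 L2 = n"
    "\<And>i. i \<le> L2 \<Longrightarrow> u2 i \<le> n" "\<And>i. i \<le> L2 \<Longrightarrow> v2 i \<le> n"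
    "\<And>i. i \<le> L2 \<Longrightarrow> f (a + u2 i) = g (a + v2 i)"
    using mountain_descending[OF wb(1) eb(1,3) bb(1) wb(2) eb(2,4) bb(2)] by metis
  define m where "m = N - b"
  have bm: "b + m = N" using ab m_def by simp
  \<comment> \<open>On \<open>[b, N]\<close> the two maps coincide, so both climbers move
    together.\<close>
  have w3: "walk m (\<lambda>i. b + i)" by (simp add: walk_def near_def)
  define P where "P x y \<longleftrightarrow> x \<le> N \<and> y \<le> N \<and> f x = g y \<and> (a < x \<and> x < b \<longrightarrow> a \<le> y \<and> y \<le> b)" for x y
  define u where "u = cat L1 u1 (cat L2 (\<lambda>i. a + u2 i) (\<lambda>i. b + i))"
  define v where "v = cat L1 v1 (cat L2 (\<lambda>i. a + v2 i) (\<lambda>i. b + i))"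
  have P1: "P (u1 i) (v1 i)" if "i \<le> L1" for i
    using 1(7,8,9)[OF that] ab by (auto simp: P_def)
  have P2: "P (a + u2 i) (a + v2 i)" if "i \<le> L2" for i
    using 2(7,8,9)[OF that] ab an by (auto simp: P_def)
  have P3: "P (b + i) (b + i)" if "i \<le> m" for i
  proof -
    have "b \<le> b + i" "b + i \<le> N" using that bm by auto
    then show ?thesis using z' by (auto simp: P_def)
  qed
  have P23: "P (cat L2 (\<lambda>i. a + u2 i) (\<lambda>i. b + i) i) (cat L2 (\<lambda>i. a + v2 i) (\<lambda>i. b + i) i)"
    if "i \<le> L2 + m" for i by (rule cat_all2[where P = P, OF P2 P3 that])
  have P: "P (u i) (v i)" if "i \<le> L1 + (L2 + m)" for i
    unfolding u_def v_def by (rule cat_all2[where P = P, OF P1 P23 that])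
  have j2: "cat L2 (\<lambda>i. a + u2 i) (\<lambda>i. b + i) 0 = a" "cat L2 (\<lambda>i. a + v2 i) (\<lambda>i. b + i) 0 = a"
    using 2 by (auto simp: cat_left)
  have wu: "walk (L1 + (L2 + m)) u" unfolding u_def
    by (intro walk_cat walk_offset 1 2 w3) (use 1 2 an j2 in auto)
  have wv: "walk (L1 + (L2 + m)) v" unfolding v_def
    by (intro walk_cat walk_offset 1 2 w3) (use 1 2 an j2 in auto)
  have "u 0 = 0" "v 0 = 0" using 1 by (auto simp: u_def v_def cat_left)
  moreover have "u (L1 + (L2 + m)) = N" "v (L1 + (L2 + m)) = N"
    using 1 2 an bm j2 by (auto simp: u_def v_def cat_right)
  ultimately show ?thesis
    by (intro that[of "L1 + (L2 + m)" u v] wu wv) (use P in \<open>auto simp: P_def\<close>)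
qed

text \<open>Go down from \<open>p\<close> to \<open>0\<close>, up to \<open>A\<close>, and down
  again to \<open>q\<close>.\<close>

lemma covering_walk:
  assumes "p \<le> A" "q \<le> (A::nat)"
  obtains n w where "walk n w" "w 0 = p" "w n = q" "w ` {0..n} = {0..A}"
proof
  let ?w = "\<lambda>i. if i \<le> p then p - i else if i \<le> p + A then i - p else p + 2 * A - i"
  let ?n = "p + A + (A - q)"
  show "walk ?n ?w" using assms unfolding walk_def near_def by auto
  show "?w 0 = p" by simp
  show "?w ?n = q" using assms by auto
  show "?w ` {0..?n} = {0..A}"
  proof
    show "?w ` {0..?n} \<subseteq> {0..A}" using assms by auto
    show "{0..A} \<subseteq> ?w ` {0..?n}"
    proof
      fix x assume "x \<in> {0..A}"
      then show "x \<in> ?w ` {0..?n}" by (intro image_eqI[of _ _ "p + x"]) auto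
    qed
  qed
qed

text \<open>Move straight from \<open>p\<close> towards \<open>q\<close> and stop at the first visit
  of \<open>r\<close> to \<open>b\<close>. As \<open>r\<close> starts at \<open>N \<ge> b\<close>,
  it cannot be below \<open>b\<close> before that.\<close>

lemma first_descent:
  assumes r: "walk A r" "\<And>i. i \<le> A \<Longrightarrow> r i \<le> N" "p \<le> A" "r p = N" "q \<le> A" "r q = b"
  obtains n s where "walk n s" "s 0 = p" "r (s n) = b" "\<And>i. i \<le> n \<Longrightarrow> s i \<le> A \<and> b \<le> r (s i)"
proof -
  define s where "s i = (if p \<le> q then p + i else p - i)" for i
  define n0 where "n0 = (if p \<le> q then q - p else p - q)"
  have sA: "s i \<le> A" if "i \<le> n0" for i using that assms by (auto simp: s_def n0_def)
  have s0: "s 0 = p" by (simp add: s_def)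
  have ws: "walk n0 s" by (auto simp: walk_def near_def s_def n0_def)
  have ex: "r (s n0) = b" using assms by (auto simp: s_def n0_def)
  define n where "n = (LEAST i. r (s i) = b)"
  have n: "r (s n) = b" "n \<le> n0" unfolding n_def using ex by (auto intro: LeastI Least_le)
  have wrs: "walk n0 (\<lambda>i. r (s i))" by (rule walk_comp[OF r(1) ws sA])
  have ge: "b \<le> r (s i)" if "i \<le> n" for i using that
  proof (induction i)
    case 0
    then show ?case using assms s0 by auto
  next
    case (Suc i)
    then have "r (s i) \<noteq> b" using not_less_Least[of i "\<lambda>i. r (s i) = b"] unfolding n_def by simp
    moreover have "near 1 (r (s i)) (r (s (Suc i)))" using walkD[OF wrs] Suc n by simp
    ultimately show ?case using Suc unfolding near_def by linarith
  qed
  have "walk n s" using walk_shift[OF ws, of 0 n] n by simp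
  with s0 n ge show ?thesis by (intro that[of n s]) (use sA in auto)
qed

lemma near_div5: "near 5 x y \<Longrightarrow> near 1 (x div 5) (y div 5)"
  unfolding near_def by linarith

lemma contracting_stretch: "walk n f \<Longrightarrow> contracting (5 * n) (\<lambda>i. f (i div 5))"
  unfolding contracting_def by (intro allI impI walk_near[of n f] near_div5) (assumption | linarith)+

text \<open>Everything is precomposed with \<open>i \<mapsto> i div 5\<close>, so that the new maps bring points at distance at most
  \<open>5\<close> together: this keeps the errors of the approximations to \<open>\<sigma>\<close> from accumulating.\<close>

lemma zigzag_extend:
  assumes z: "zigzag N a b M t f g" and r: "walk A r" "r ` {0..A} = {0..N}"
  obtains N' a' b' f' g' k where "zigzag N' a' b' N b f' g'" "drift a' b' N b f' g'"
    "linked a b f g N' f' g'" "\<And>x. x \<le> N' \<Longrightarrow> f' x = r (k x)" "walk N' k" "k ` {0..N'} = {0..A}"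
proof -
  note z' = z[unfolded zigzag_def]
  have bN: "b \<le> N" and cf: "contracting N f" using z' by auto
  have fg: "f x = g x" if "b \<le> x" "x \<le> N" for x using z' that by auto
  have rN: "r i \<le> N" if "i \<le> A" for i using r(2) that by (metis atLeastAtMost_iff image_eqI le0)
  have r_onto: "\<exists>q\<le>A. r q = x" if "x \<le> N" for x
  proof -
    have "x \<in> r ` {0..A}" using r(2) that by simp
    then show ?thesis by auto
  qed
  \<comment> \<open>Points over the bottom \<open>0\<close> and the top \<open>N\<close>, between
    which a covering walk is taken, and a point over \<open>b\<close> as target of the
    descent.\<close>
  obtain \<alpha>0 where a0: "\<alpha>0 \<le> A" "r \<alpha>0 = 0" using r_onto[of 0] by auto
  obtain \<alpha>1 where a1: "\<alpha>1 \<le> A" "r \<alpha>1 = N" using r_onto[of N] by auto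
  obtain q where q: "q \<le> A" "r q = b" using r_onto[OF bN] by auto
  obtain m w where w: "walk m w" "w 0 = \<alpha>0" "w m = \<alpha>1" "w ` {0..m} = {0..A}"
    using covering_walk[OF a0(1) a1(1)] .
  have wA: "w i \<le> A" if "i \<le> m" for i using w(4) that by (metis atLeastAtMost_iff image_eqI le0)
  obtain \<delta> s where s: "walk \<delta> s" "s 0 = \<alpha>1" "r (s \<delta>) = b"
    "\<And>i. i \<le> \<delta> \<Longrightarrow> s i \<le> A \<and> b \<le> r (s i)"
    using first_descent[OF r(1) rN a1 q] by metis
  obtain L u v where uv: "walk L u" "walk L v" "u 0 = 0" "v 0 = 0" "u L = N" "v L = N"
    "\<And>i. i \<le> L \<Longrightarrow> u i \<le> N" "\<And>i. i \<le> L \<Longrightarrow> v i \<le> N"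
    "\<And>i. i \<le> L \<Longrightarrow> f (u i) = g (v i) \<and> (a < u i \<and> u i < b \<longrightarrow> a \<le> v i \<and> v i \<le> b)"
    using zigzag_climb[OF z] by metis
  have wrw: "walk m (\<lambda>i. r (w i))" by (rule walk_comp[OF r(1) w(1) wA])
  \<comment> \<open>First segment: \<open>u\<close> and \<open>r \<circ> w\<close> both climb from
    \<open>0\<close> to \<open>N\<close>. With \<open>\<kappa> = w \<circ> j1\<close> and
    \<open>y = v \<circ> e1\<close> the equation \<open>f (r \<kappa>) = g y\<close> becomes
    exact.\<close>
  obtain L1 e1 j1 where 1: "walk L1 e1" "walk L1 j1" "e1 0 = 0" "j1 0 = 0" "e1 L1 = L" "j1 L1 = m"
    "\<And>i. i \<le> L1 \<Longrightarrow> e1 i \<le> L" "\<And>i. i \<le> L1 \<Longrightarrow> j1 i \<le> m" "\<And>i. i \<le> L1 \<Longrightarrow> u (e1 i) = r (w (j1 i))"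
    by (rule mountain_climbing[OF uv(1,3,5) _ wrw])
      (use uv w a0 a1 wA rN in auto)
  \<comment> \<open>Second segment: prescribed profiles for the new maps. \<open>G\<close> descends
    from \<open>N\<close> to \<open>b\<close> at unit speed, \<open>F\<close> does so two steps
    later, and \<open>J\<close> is a time at which both are at \<open>b\<close>.\<close>
  define J where "J = N + 2 - b"
  define F where "F j = min N (N + 2 - j)" for j
  define G where "G j = max b (N - j)" for j
  have wF: "walk J F" "walk J G" by (auto simp: walk_def near_def F_def G_def)
  have FG: "b \<le> F j" "F j \<le> N" "b \<le> G j" "G j \<le> N" "G j \<le> F j" "F j \<le> G j + 2" "b < G j \<longrightarrow> F j = min N (G j + 2)"
    if "j \<le> J" for j
  proof -
    have j: "j + b \<le> N + 2" using that bN unfolding J_def by linarith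
    show "b \<le> F j" "F j \<le> N" "b \<le> G j" "G j \<le> N" "G j \<le> F j" "F j \<le> G j + 2"
      using j bN unfolding F_def G_def by linarith+
    show "b < G j \<longrightarrow> F j = min N (G j + 2)"
      using j bN unfolding F_def G_def by (intro impI) linarith
  qed
  have FGe: "F 0 = N" "F J = b" "G 0 = N" "G J = b" using bN by (auto simp: F_def G_def J_def)
  have wrs: "walk \<delta> (\<lambda>i. r (s i))" by (rule walk_comp[OF r(1) s(1)]) (use s(4) in auto)
  have Fb: "b \<le> F i \<and> F i \<le> N" if "i \<le> J" for i using FG[OF that] by simp
  have rs0: "r (s 0) = N" using s a1 by simp
  have rsb: "b \<le> r (s i) \<and> r (s i) \<le> N" if "i \<le> \<delta>" for i using s(4)[OF that] rN by simp
  \<comment> \<open>The new \<open>f\<close> must factor through \<open>r\<close>, so only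
    \<open>F\<close> is lifted along \<open>r \<circ> s\<close>; \<open>G\<close> is carried along
    by the same parametrization.\<close>
  obtain L2 e2 j2 where 2: "walk L2 e2" "walk L2 j2" "e2 0 = 0" "j2 0 = 0" "e2 L2 = J" "j2 L2 = \<delta>"
    "\<And>i. i \<le> L2 \<Longrightarrow> e2 i \<le> J" "\<And>i. i \<le> L2 \<Longrightarrow> j2 i \<le> \<delta>" "\<And>i. i \<le> L2 \<Longrightarrow> F (e2 i) = r (s (j2 i))"
    using mountain_descending[OF wF(1) FGe(1,2) Fb wrs rs0 s(3) rsb] by metis
  \<comment> \<open>The third segment retraces \<open>s\<close> from \<open>b\<close> back to
    \<open>N\<close> with both maps equal, as the next zigzag demands.\<close>
  define \<kappa> where "\<kappa> = cat L1 (\<lambda>i. w (j1 i)) (cat L2 (\<lambda>i. s (j2 i)) (\<lambda>i. s (\<delta> - i)))"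
  define y where "y = cat L1 (\<lambda>i. v (e1 i)) (cat L2 (\<lambda>i. G (e2 i)) (\<lambda>i. r (s (\<delta> - i))))"
  define T where "T = L1 + (L2 + \<delta>)"
  have jk: "w (j1 L1) = cat L2 (\<lambda>i. s (j2 i)) (\<lambda>i. s (\<delta> - i)) 0" "s (j2 L2) = s (\<delta> - 0)"
    by (simp_all add: cat_left 1(3-6) 2(3-6) s(2,3) w(3))
  have jy: "v (e1 L1) = cat L2 (\<lambda>i. G (e2 i)) (\<lambda>i. r (s (\<delta> - i))) 0" "G (e2 L2) = r (s (\<delta> - 0))"
    by (simp_all add: cat_left 1(3-6) 2(3-6) s(2,3) uv(6) FGe)
  have w\<kappa>: "walk T \<kappa>" unfolding T_def \<kappa>_def
    by (intro walk_cat jk walk_comp[OF w(1) 1(2)] walk_comp[OF s(1) 2(2)] walk_rev s 1 2)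
  have wy: "walk T y" unfolding T_def y_def
    by (intro walk_cat jy walk_comp[OF uv(2) 1(1)] walk_comp[OF wF(2) 2(1)] walk_rev[OF wrs] 1 2)
  have K1: "\<kappa> i = w (j1 i)" "y i = v (e1 i)" if "i \<le> L1" for i
    using that by (auto simp: \<kappa>_def y_def cat_left)
  have K2: "\<kappa> i = s (j2 (i - L1))" "y i = G (e2 (i - L1))" if "L1 \<le> i" "i \<le> L1 + L2" for i
    using that jk jy by (auto simp: \<kappa>_def y_def cat_right cat_left)
  have K3: "\<kappa> i = s (\<delta> - (i - L1 - L2))" "y i = r (s (\<delta> - (i - L1 - L2)))" if "L1 + L2 \<le> i" "i \<le> T" for i
  proof -
    from that(1) obtain c where c: "i = L1 + (L2 + c)" by (metis add.assoc le_Suc_ex)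
    show "\<kappa> i = s (\<delta> - (i - L1 - L2))" "y i = r (s (\<delta> - (i - L1 - L2)))"
      using jk jy by (simp_all add: \<kappa>_def y_def cat_right c)
  qed
  have Q1: "\<kappa> i \<le> A \<and> y i \<le> N \<and> f (r (\<kappa> i)) = g (y i) \<and>
      (a < r (\<kappa> i) \<and> r (\<kappa> i) < b \<longrightarrow> a \<le> y i \<and> y i \<le> b)" if "i \<le> L1" for i
    using K1[OF that] 1(7,8)[OF that] 1(9)[OF that, symmetric]
      wA[OF 1(8)[OF that]] uv(8,9)[OF 1(7)[OF that]] by simp
  have Q2: "\<kappa> i \<le> A \<and> b \<le> r (\<kappa> i) \<and> b \<le> y i \<and> y i \<le> N \<and> y i \<le> r (\<kappa> i) \<and> r (\<kappa> i) \<le> y i + 2 \<and>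
      (b < y i \<longrightarrow> r (\<kappa> i) = min N (y i + 2))" if "L1 \<le> i" "i \<le> L1 + L2" for i
  proof -
    have i: "i - L1 \<le> L2" using that by simp
    show ?thesis
      using K2[OF that] 2(9)[OF i, symmetric] FG[OF 2(7)[OF i]] s(4)[OF 2(8)[OF i]] by simp
  qed
  have Q3: "\<kappa> i \<le> A \<and> b \<le> r (\<kappa> i) \<and> y i = r (\<kappa> i)" if "L1 + L2 \<le> i" "i \<le> T" for i
    using K3[OF that] s(4)[of "\<delta> - (i - L1 - L2)"] by simp
  have "\<kappa> i \<le> A \<and> y i \<le> N" if "i \<le> T" for i
  proof -
    consider "i \<le> L1" | "L1 \<le> i" "i \<le> L1 + L2" | "L1 + L2 \<le> i" by linarith
    then show ?thesis
    proof cases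
      case 1
      then show ?thesis using Q1[of i] by blast
    next
      case 2
      then show ?thesis using Q2[of i] by blast
    next
      case 3
      then show ?thesis using Q3[OF 3 that] rN[of "\<kappa> i"] by simp
    qed
  qed
  then have \<kappa>A: "\<kappa> i \<le> A" and yN: "y i \<le> N" if "i \<le> T" for i using that by blast+
  have wr\<kappa>: "walk T (\<lambda>i. r (\<kappa> i))" by (rule walk_comp[OF r(1) w\<kappa> \<kappa>A])
  have E0: "r (\<kappa> 0) = 0" "y 0 = 0" using K1[of 0] by (simp_all add: 1(3,4) w(2) a0 uv(4))
  have E1: "r (\<kappa> L1) = N" "y L1 = N" using K1[of L1] by (simp_all add: 1(5,6) w(3) a1 uv(6))
  have E2: "r (\<kappa> (L1 + L2)) = b" "y (L1 + L2) = b" using K2[of "L1 + L2"] by (simp_all add: 2(5,6) s(3) FGe)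
  have E3: "r (\<kappa> T) = N" "y T = N" using K3[of T] by (simp_all add: T_def s(2) a1)
  let ?N = "5 * T" and ?a = "5 * L1" and ?b = "5 * (L1 + L2)"
  let ?k = "\<lambda>i. \<kappa> (i div 5)" and ?g = "\<lambda>i. y (i div 5)"
  let ?f = "\<lambda>i. r (?k i)"
  have d: "x div 5 \<le> T" if "x \<le> ?N" for x using that by auto
  have d1: "x div 5 \<le> L1" if "x \<le> ?a" for x using that by auto
  have d2: "L1 \<le> x div 5 \<and> x div 5 \<le> L1 + L2" if "?a \<le> x \<and> x \<le> ?b" for x using that by auto
  have d3: "L1 + L2 \<le> x div 5 \<and> x div 5 \<le> T" if "?b \<le> x \<and> x \<le> ?N" for x using that by auto
  have "zigzag ?N ?a ?b N b ?f ?g" unfolding zigzag_def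
  proof (intro conjI allI impI)
    show "contracting ?N ?f" by (rule contracting_stretch[OF wr\<kappa>])
    show "contracting ?N ?g" by (rule contracting_stretch[OF wy])
  next
    fix x assume "x \<le> ?N"
    then show "?f x \<le> N" "?g x \<le> N" using d[of x] rN \<kappa>A yN by auto
  next
    fix x assume "?a \<le> x \<and> x \<le> ?b"
    then show "b \<le> ?f x" "b \<le> ?g x" using d2[of x] Q2 by auto
  next
    fix x assume "?b \<le> x \<and> x \<le> ?N"
    then show "?f x = ?g x" "b \<le> ?f x" using d3[of x] Q3 by auto
  qed (use E0 E1 E2 E3 in \<open>auto simp: T_def\<close>)
  moreover have "drift ?a ?b N b ?f ?g" unfolding drift_def
    using d2 Q2 by blast
  moreover have "linked a b f g ?N ?f ?g" unfolding linked_def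
  proof (intro allI impI)
    fix x assume x: "x \<le> ?N"
    let ?i = "x div 5"
    consider "?i \<le> L1" | "L1 \<le> ?i" "?i \<le> L1 + L2" | "L1 + L2 \<le> ?i" "?i \<le> T" using d[OF x] by linarith
    then show "near 1 (f (?f x)) (g (?g x)) \<and>
       (a < ?f x \<and> ?f x < b \<longrightarrow> a \<le> ?g x \<and> ?g x \<le> b \<and> f (?f x) = g (?g x))"
    proof cases
      case 1
      then show ?thesis using Q1[of ?i] by auto
    next
      case 2
      \<comment> \<open>Only this segment is amalgamated up to adjacency: the two values differ by
        at most \<open>2\<close>, \<open>f\<close> contracts, and \<open>f = g\<close> above
        \<open>b\<close>. The locality premise fails because \<open>?f x\<close> is at least
        \<open>b\<close>.\<close>
      have n5: "near 5 (?f x) (?g x)" using Q2[OF 2] by (auto simp: near_def)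
      have "near 1 (f (?f x)) (f (?g x))"
        using cf n5 rN[OF \<kappa>A[OF d[OF x]]] yN[OF d[OF x]] unfolding contracting_def by blast
      then show ?thesis using Q2[OF 2] fg[of "?g x"] by auto
    next
      case 3
      then show ?thesis using Q3[OF 3] fg[of "?g x"] yN[OF d[OF x]] by auto
    qed
  qed
  moreover have "?f x = r (?k x)" if "x \<le> ?N" for x
    by (rule refl)
  moreover have "walk ?N ?k"
    using contracting_walk[OF contracting_stretch[OF w\<kappa>]] .
  moreover have "?k ` {0..?N} = {0..A}"
  proof
    show "?k ` {0..?N} \<subseteq> {0..A}" using \<kappa>A d by auto
    show "{0..A} \<subseteq> ?k ` {0..?N}"
    proof
      fix x assume "x \<in> {0..A}"
      then have "x \<in> w ` {0..m}" using w(4) by simp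
      then obtain j where j: "j \<le> m" "w j = x" by auto
      \<comment> \<open>The first segment alone is onto: \<open>j1\<close> runs through
        \<open>[0, m]\<close>, and \<open>w\<close> covers \<open>[0, A]\<close>.\<close>
      obtain i where i: "i \<le> L1" "j1 i = j"
        using walk_attains[OF 1(2), of 0 L1 j] 1(4,6) j by auto
      show "x \<in> ?k ` {0..?N}"
        by (rule image_eqI[of _ _ "5 * i"]) (use K1[OF i(1)] i j in \<open>auto simp: T_def\<close>)
    qed
  qed
  ultimately show ?thesis by (rule that)
qed

subsection \<open>Towers of paths in a generic sequence\<close>

definition path_graph :: "nat \<Rightarrow> nat graph" where
  "path_graph N = \<lparr>carrier = {0..N}, adj = {(i, j). i \<le> N \<and> j \<le> N \<and> near 1 i j}\<rparr>"

lemma carrier_path_graph [simp]: "carrier (path_graph N) = {0..N}"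
  by (simp add: path_graph_def)

lemma adj_path_graph: "(i, j) \<in> adj (path_graph N) \<longleftrightarrow> i \<le> N \<and> j \<le> N \<and> near 1 i j"
  by (simp add: path_graph_def)

lemma near_int: "near (Suc 0) i j \<longleftrightarrow> \<bar>int i - int j\<bar> \<le> 1"
  unfolding near_def by linarith

lemma linear_graph_path: "linear_graph (path_graph N)"
  unfolding linear_graph_def
  by (rule exI[of _ N], rule exI[of _ id]) (auto simp: path_graph_def near_int)

lemma linear_graphE:
  assumes "linear_graph G"
  obtains n \<alpha> where "bij_betw \<alpha> {0..n} (carrier G)"
    "\<And>u v. (u, v) \<in> adj G \<longleftrightarrow> (\<exists>i j. i \<le> n \<and> j \<le> n \<and> near 1 i j \<and> u = \<alpha> i \<and> v = \<alpha> j)"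
proof -
  obtain n \<alpha> where "bij_betw \<alpha> {0..n} (carrier G)"
     "adj G = {(\<alpha> i, \<alpha> j) |i j. i \<in> {0..n} \<and> j \<in> {0..n} \<and> \<bar>int i - int j\<bar> \<le> 1}"
    using assms unfolding linear_graph_def by blast
  then show ?thesis by (intro that[of \<alpha> n]) (auto simp: near_int)
qed

lemma linear_graph_adjD:
  assumes "linear_graph G" "(u, v) \<in> adj G"
  shows "u \<in> carrier G" "v \<in> carrier G"
proof -
  obtain n \<alpha> where "bij_betw \<alpha> {0..n} (carrier G)"
    "\<And>u v. (u, v) \<in> adj G \<longleftrightarrow> (\<exists>i j. i \<le> n \<and> j \<le> n \<and> near 1 i j \<and> u = \<alpha> i \<and> v = \<alpha> j)"
    by (rule linear_graphE[OF assms(1)]) blast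
  then show "u \<in> carrier G" "v \<in> carrier G" using assms(2) by (auto simp: bij_betw_def)
qed

lemma linear_graph_finite: "linear_graph G \<Longrightarrow> finite (carrier G)"
  unfolding linear_graph_def using bij_betw_finite by blast

lemma linear_graph_adj_refl:
  assumes "linear_graph G" "u \<in> carrier G"
  shows "(u, u) \<in> adj G"
proof -
  obtain n \<alpha> where *: "bij_betw \<alpha> {0..n} (carrier G)"
    "\<And>u v. (u, v) \<in> adj G \<longleftrightarrow> (\<exists>i j. i \<le> n \<and> j \<le> n \<and> near 1 i j \<and> u = \<alpha> i \<and> v = \<alpha> j)"
    by (rule linear_graphE[OF assms(1)]) blast
  have "u \<in> \<alpha> ` {0..n}" using bij_betw_imp_surj_on[OF *(1)] assms(2) by simp
  then obtain i where "i \<le> n" "u = \<alpha> i" by auto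
  then show ?thesis unfolding * by (intro exI[of _ i] conjI) simp_all
qed

lemma Epi_carrier: "f \<in> Epi G H \<Longrightarrow> x \<in> carrier G \<Longrightarrow> f x \<in> carrier H"
  by (auto simp: Epi_def)

lemma Epi_adj: "f \<in> Epi G H \<Longrightarrow> (x, y) \<in> adj G \<Longrightarrow> (f x, f y) \<in> adj H"
  by (auto simp: Epi_def)

lemma Epi_onto:
  assumes "f \<in> Epi G H" "linear_graph G" "linear_graph H" "v \<in> carrier H"
  obtains x where "x \<in> carrier G" "f x = v"
proof -
  have "\<exists>x y. (x, y) \<in> adj G \<and> f x = v \<and> f y = v"
    using assms(1) linear_graph_adj_refl[OF assms(3,4)] unfolding Epi_def by blast
  then show ?thesis using that linear_graph_adjD[OF assms(2)] by blast
qed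

lemma last_before:
  assumes "P x" "\<not> P y" "x \<le> (y::nat)"
  shows "\<exists>z. x \<le> z \<and> z < y \<and> P z \<and> \<not> P (Suc z)"
  using assms(3,2,1)
proof (induction y rule: dec_induct)
  case (step y)
  then show ?case by (cases "P y") (auto intro: exI[of _ y] simp: less_Suc_eq)
qed simp

text \<open>Between two indices whose values differ by 1, some single step makes exactly this
  change. Hence a walk that is onto vertices is onto edges, as \<open>Epi\<close> requires.\<close>

lemma walk_edge:
  assumes w: "walk n f" and "x \<le> n" "y \<le> n" "near 1 (f x) (f y)"
  shows "\<exists>x'\<le>n. \<exists>y'\<le>n. near 1 x' y' \<and> f x' = f x \<and> f y' = f y"
proof -
  have up: "\<exists>x'\<le>n. \<exists>y'\<le>n. near 1 x' y' \<and> f x' = f x \<and> f y' = f y"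
    if xy: "x \<le> n" "y \<le> n" "f y = Suc (f x)" for x y
  proof (cases "x \<le> y")
    case True
    obtain z where z: "z < y" "f z \<le> f x" "\<not> f (Suc z) \<le> f x"
      using last_before[of "\<lambda>z. f z \<le> f x" x y] True xy by auto
    have "near 1 (f z) (f (Suc z))" using walkD[OF w] z xy by simp
    with z(2,3) xy(3) have "f z = f x" "f (Suc z) = f y" unfolding near_def by linarith+
    moreover have "near 1 z (Suc z)" by (simp add: near_def)
    moreover have "z \<le> n" "Suc z \<le> n" using z xy by auto
    ultimately show ?thesis by blast
  next
    case False
    obtain z where z: "z < x" "f x < f z" "\<not> f x < f (Suc z)"
      using last_before[of "\<lambda>z. f x < f z" y x] False xy by auto
    have "near 1 (f z) (f (Suc z))" using walkD[OF w] z xy by simp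
    with z(2,3) xy(3) have "f (Suc z) = f x" "f z = f y" unfolding near_def by linarith+
    moreover have "near 1 (Suc z) z" by (simp add: near_def)
    moreover have "z \<le> n" "Suc z \<le> n" using z xy by auto
    ultimately show ?thesis by blast
  qed
  consider "f x = f y" | "f y = Suc (f x)" | "f x = Suc (f y)"
    using assms(4) unfolding near_def by linarith
  then show ?thesis
  proof cases
    case 1
    then show ?thesis using assms by (intro exI[of _ x]) auto
  next
    case 2
    then show ?thesis using up assms by blast
  next
    case 3
    then show ?thesis using up[of y x] assms near_sym by blast
  qed
qed

lemma bond_carrier:
  assumes "\<And>n. p n \<in> Epi (A (Suc n)) (A n)" "x \<in> carrier (A (m + k))"
  shows "bond p m k x \<in> carrier (A m)"
  using assms(2)
proof (induction k arbitrary: x)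
  case (Suc k)
  then show ?case using Epi_carrier[OF assms(1), of x "m + k"] by simp
qed simp

lemma bond_adj:
  assumes "\<And>n. p n \<in> Epi (A (Suc n)) (A n)" "(x, y) \<in> adj (A (m + k))"
  shows "(bond p m k x, bond p m k y) \<in> adj (A m)"
  using assms(2)
proof (induction k arbitrary: x y)
  case (Suc k)
  then show ?case using Epi_adj[OF assms(1), of x y "m + k"] by simp
qed simp

lemma bond_inv_limit: "x \<in> inv_limit A p \<Longrightarrow> bond p m k (x (m + k)) = x m"
  by (induction k) (auto simp: inv_limit_def)

text \<open>An enumeration of \<open>A l\<close> turns \<open>r\<close> into a surjective walk. Then
  \<open>zigzag_extend\<close> yields an epimorphism \<open>k\<close> from a new path onto
  \<open>A l\<close>, and genericity factors a bonding map through \<open>k\<close>.\<close>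

lemma generic_step:
  assumes gen: "generic_sequence A p" and r: "r \<in> Epi (A l) (path_graph N)" and z: "zigzag N a b M t f g"
  shows "\<exists>l' N' a' b' r' f' g' k. l < l' \<and> r' \<in> Epi (A l') (path_graph N') \<and>
     zigzag N' a' b' N b f' g' \<and> drift a' b' N b f' g' \<and> linked a b f g N' f' g' \<and>
     (\<forall>x y. (x, y) \<in> adj (path_graph N') \<longrightarrow> (k x, k y) \<in> adj (A l)) \<and>
     (\<forall>v\<in>carrier (A l'). k (r' v) = bond p l (l' - l) v) \<and> (\<forall>x\<le>N'. f' x = r (k x))"
proof -
  have lin: "linear_graph (A l)" using gen by (simp add: generic_sequence_def)
  obtain n \<alpha> where \<alpha>: "bij_betw \<alpha> {0..n} (carrier (A l))"
    "\<And>u v. (u, v) \<in> adj (A l) \<longleftrightarrow> (\<exists>i j. i \<le> n \<and> j \<le> n \<and> near 1 i j \<and> u = \<alpha> i \<and> v = \<alpha> j)"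
    by (rule linear_graphE[OF lin]) blast
  have \<alpha>c: "\<alpha> i \<in> carrier (A l)" if "i \<le> n" for i using \<alpha>(1) that by (auto simp: bij_betw_def)
  have adj\<alpha>: "(\<alpha> i, \<alpha> j) \<in> adj (A l)" if "i \<le> n" "j \<le> n" "near 1 i j" for i j
    using that unfolding \<alpha>(2) by blast
  have w: "walk n (\<lambda>i. r (\<alpha> i))" unfolding walk_def
  proof (intro allI impI)
    fix i assume "i < n"
    then have "(\<alpha> i, \<alpha> (Suc i)) \<in> adj (A l)" by (intro adj\<alpha>) (auto simp: near_def)
    then show "near 1 (r (\<alpha> i)) (r (\<alpha> (Suc i)))" using Epi_adj[OF r] adj_path_graph by blast
  qed
  have im: "(\<lambda>i. r (\<alpha> i)) ` {0..n} = {0..N}"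
  proof
    show "(\<lambda>i. r (\<alpha> i)) ` {0..n} \<subseteq> {0..N}" using Epi_carrier[OF r] \<alpha>c by auto
    show "{0..N} \<subseteq> (\<lambda>i. r (\<alpha> i)) ` {0..n}"
    proof
      fix v assume "v \<in> {0..N}"
      then obtain x where x: "x \<in> carrier (A l)" "r x = v"
        using Epi_onto[OF r lin linear_graph_path] by auto
      then have "x \<in> \<alpha> ` {0..n}" using bij_betw_imp_surj_on[OF \<alpha>(1)] by simp
      then obtain i where "i \<in> {0..n}" "x = \<alpha> i" by auto
      then show "v \<in> (\<lambda>i. r (\<alpha> i)) ` {0..n}" using x by auto
    qed
  qed
  obtain N' a' b' f' g' \<kappa> where e: "zigzag N' a' b' N b f' g'" "drift a' b' N b f' g'"
    "linked a b f g N' f' g'" "\<And>x. x \<le> N' \<Longrightarrow> f' x = r (\<alpha> (\<kappa> x))" "walk N' \<kappa>" "\<kappa> ` {0..N'} = {0..n}"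
    using zigzag_extend[OF z w im] by metis
  \<comment> \<open>Elements of \<open>Epi\<close> are extensional, hence the restriction.\<close>
  define k where "k = restrict (\<lambda>x. \<alpha> (\<kappa> x)) {0..N'}"
  have kx: "k x = \<alpha> (\<kappa> x)" if "x \<le> N'" for x using that by (simp add: k_def)
  have \<kappa>n: "\<kappa> x \<le> n" if "x \<le> N'" for x using e(6) that by (metis atLeastAtMost_iff image_eqI le0)
  have k_adj: "(k x, k y) \<in> adj (A l)" if "(x, y) \<in> adj (path_graph N')" for x y
  proof -
    have xy: "x \<le> N'" "y \<le> N'" "near 1 x y" using that by (auto simp: adj_path_graph)
    have "near 1 (\<kappa> x) (\<kappa> y)" by (rule walk_near[OF e(5) xy])
    then show ?thesis using adj\<alpha> \<kappa>n xy by (simp add: kx)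
  qed
  have "k \<in> Epi (path_graph N') (A l)" unfolding Epi_def
  proof (intro CollectI conjI allI impI)
    show "k \<in> carrier (path_graph N') \<rightarrow>\<^sub>E carrier (A l)"
      using \<alpha>c \<kappa>n by (auto simp: k_def)
    show "(k x, k y) \<in> adj (A l)" if "(x, y) \<in> adj (path_graph N')" for x y by (rule k_adj[OF that])
    fix u v assume "(u, v) \<in> adj (A l)"
    then obtain i j where ij: "i \<le> n" "j \<le> n" "near 1 i j" "u = \<alpha> i" "v = \<alpha> j"
      unfolding \<alpha>(2) by blast
    have "i \<in> \<kappa> ` {0..N'}" "j \<in> \<kappa> ` {0..N'}" using e(6) ij by auto
    then obtain x y where xy: "x \<le> N'" "\<kappa> x = i" "y \<le> N'" "\<kappa> y = j" by auto
    obtain x' y' where "x' \<le> N'" "y' \<le> N'" "near 1 x' y'" "\<kappa> x' = \<kappa> x" "\<kappa> y' = \<kappa> y"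
      using walk_edge[OF e(5) xy(1,3)] xy ij by blast
    then have "(x', y') \<in> adj (path_graph N') \<and> k x' = u \<and> k y' = v"
      using xy ij by (auto simp: adj_path_graph kx)
    then show "\<exists>x y. (x, y) \<in> adj (path_graph N') \<and> k x = u \<and> k y = v" by blast
  qed
  then obtain l' r' where l': "l < l'" "r' \<in> Epi (A l') (path_graph N')"
     and co: "compose (carrier (A l')) k r' = restrict (bond p l (l' - l)) (carrier (A l'))"
    using gen linear_graph_path unfolding generic_sequence_def by blast
  have "k (r' v) = bond p l (l' - l) v" if "v \<in> carrier (A l')" for v
    using fun_cong[OF co, of v] that by (simp add: compose_def)
  moreover have "\<forall>x\<le>N'. f' x = r (k x)" using e(4) kx by simp
  ultimately show ?thesis using l' e(1-3) k_adj by blast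
qed

text \<open>The maps \<open>r n\<close> and \<open>k n\<close> interleave the paths with the given sequence, as in
  \<open>A (l (n + 1)) \<rightarrow> B (n + 1) \<rightarrow> A (l n) \<rightarrow> B n\<close>.\<close>

locale tower =
  fixes A :: "nat \<Rightarrow> nat graph" and p :: "nat \<Rightarrow> nat \<Rightarrow> nat"
    and l N a b :: "nat \<Rightarrow> nat" and r f g k :: "nat \<Rightarrow> nat \<Rightarrow> nat"
  assumes gen: "generic_sequence A p"
    and l_less: "l n < l (Suc n)"
    and r_Epi: "r n \<in> Epi (A (l n)) (path_graph (N n))"
    and zigzag: "zigzag (N (Suc n)) (a (Suc n)) (b (Suc n)) (N n) (b n) (f n) (g n)"
    and drift: "drift (a (Suc n)) (b (Suc n)) (N n) (b n) (f n) (g n)"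
    and linked: "linked (a (Suc n)) (b (Suc n)) (f n) (g n) (N (Suc (Suc n))) (f (Suc n)) (g (Suc n))"
    and k_adj: "(x, y) \<in> adj (path_graph (N (Suc n))) \<Longrightarrow> (k n x, k n y) \<in> adj (A (l n))"
    and k_r: "v \<in> carrier (A (l (Suc n))) \<Longrightarrow> k n (r (Suc n) v) = bond p (l n) (l (Suc n) - l n) v"
    and f_eq: "x \<le> N (Suc n) \<Longrightarrow> f n x = r n (k n x)"
    and N0: "N 0 = 10" and b0: "b 0 = 0"

text \<open>Dependent choice over tuples holding all data of one level; the tuple of level
  \<open>n + 1\<close> includes the maps down to level \<open>n\<close>.\<close>

lemma generic_tower:
  assumes gen: "generic_sequence A p"
  shows "\<exists>l N a b r f g k. tower A p l N a b r f g k"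
proof -
  define I where "I n s = (case s of (l, N, a, b, r, f, g, k :: nat \<Rightarrow> nat) \<Rightarrow>
      r \<in> Epi (A l) (path_graph N) \<and> (\<exists>M t. zigzag N a b M t f g) \<and> (n = 0 \<longrightarrow> N = 10 \<and> b = 0))"
    for n :: nat and s
  define Q where "Q s s' = (case s of (l, N, a, b, r, f, g, k :: nat \<Rightarrow> nat) \<Rightarrow>
      case s' of (l', N', a', b', r' :: nat \<Rightarrow> nat, f', g', k') \<Rightarrow>
      l < l' \<and> zigzag N' a' b' N b f' g' \<and> drift a' b' N b f' g' \<and> linked a b f g N' f' g' \<and>
      (\<forall>x y. (x, y) \<in> adj (path_graph N') \<longrightarrow> (k' x, k' y) \<in> adj (A l)) \<and>
      (\<forall>v\<in>carrier (A l'). k' (r' v) = bond p l (l' - l) v) \<and> (\<forall>x\<le>N'. f' x = r (k' x)))"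
    for s s'
  obtain l0 r0 where "r0 \<in> Epi (A l0) (path_graph 10)"
    using gen linear_graph_path unfolding generic_sequence_def by blast
  \<comment> \<open>At level 0 constant maps form a degenerate zigzag with
    \<open>a = b = M = t = 0\<close>. The length \<open>10\<close> leaves room between the
    thresholds \<open>9\<close> and \<open>2\<close> of \<open>slow_orbit\<close>.\<close>
  moreover have "zigzag 10 0 0 0 0 (\<lambda>_. 0) (\<lambda>_. 0)"
    by (simp add: zigzag_def contracting_def)
  ultimately have init: "\<exists>s. I 0 s"
    by (intro exI[of _ "(l0, 10, 0, 0, r0, \<lambda>_. 0, \<lambda>_. 0, \<lambda>_. 0)"]) (auto simp: I_def)
  have step: "\<exists>s'. I (Suc n) s' \<and> Q s s'" if s: "I n s" for s n
  proof -
    obtain l N a b r f g k where s_eq: "s = (l, N, a, b, r, f, g, k)" by (cases s) auto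
    with s obtain M t where "r \<in> Epi (A l) (path_graph N)" "zigzag N a b M t f g"
      by (auto simp: I_def)
    from generic_step[OF gen this] obtain l' N' a' b' r' f' g' k' where
      "l < l'" "r' \<in> Epi (A l') (path_graph N')"
      "zigzag N' a' b' N b f' g'" "drift a' b' N b f' g'" "linked a b f g N' f' g'"
      "\<forall>x y. (x, y) \<in> adj (path_graph N') \<longrightarrow> (k' x, k' y) \<in> adj (A l)"
      "\<forall>v\<in>carrier (A l'). k' (r' v) = bond p l (l' - l) v" "\<forall>x\<le>N'. f' x = r (k' x)"
      by blast
    then show ?thesis
      by (intro exI[of _ "(l', N', a', b', r', f', g', k')"]) (auto simp: I_def Q_def s_eq)
  qed
  obtain S where S: "\<And>n. I n (S n)" "\<And>n. Q (S n) (S (Suc n))"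
    using dependent_nat_choice[of I "\<lambda>_. Q", OF init step] by blast
  define l where "l n = fst (S n)" for n
  define N where "N n = fst (snd (S n))" for n
  define a where "a n = fst (snd (snd (S n)))" for n
  define b where "b n = fst (snd (snd (snd (S n))))" for n
  define r where "r n = fst (snd (snd (snd (snd (S n)))))" for n
  define f where "f n = fst (snd (snd (snd (snd (snd (S n))))))" for n
  define g where "g n = fst (snd (snd (snd (snd (snd (snd (S n)))))))" for n
  define k where "k n = snd (snd (snd (snd (snd (snd (snd (S n)))))))" for n
  have Sn: "S n = (l n, N n, a n, b n, r n, f n, g n, k n)" for n
    by (simp add: l_def N_def a_def b_def r_def f_def g_def k_def)
  \<comment> \<open>The tower indexes maps by their target level, hence the shift.\<close>
  have "tower A p l N a b r (\<lambda>n. f (Suc n)) (\<lambda>n. g (Suc n)) (\<lambda>n. k (Suc n))"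
    using gen S unfolding I_def Q_def Sn by unfold_locales (auto 0 0)
  then show ?thesis by blast
qed

context tower
begin

section \<open>Coordinates of the limit along the tower\<close>

abbreviation "X \<equiv> inv_limit A p"

text \<open>The coordinate of \<open>x\<close> in the path of level \<open>n\<close>. By
  \<open>f_\<beta>\<close> these coordinates form a thread for the maps \<open>f n\<close>.\<close>

definition \<beta> :: "nat \<Rightarrow> (nat \<Rightarrow> nat) \<Rightarrow> nat" where
  "\<beta> n x = r n (x (l n))"

lemma lin: "linear_graph (A n)" and p_Epi: "p n \<in> Epi (A (Suc n)) (A n)"
  using gen by (auto simp: generic_sequence_def)

lemma X_carrier: "x \<in> X \<Longrightarrow> x n \<in> carrier (A n)"
  by (simp add: inv_limit_def)

lemma l_ge: "n \<le> l n"
proof (induction n)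
  case (Suc n)
  then show ?case using l_less[of n] by linarith
qed simp

lemma \<beta>_le: "x \<in> X \<Longrightarrow> \<beta> n x \<le> N n"
  using Epi_carrier[OF r_Epi, of "x (l n)" n] X_carrier[of x] by (simp add: \<beta>_def)

lemma k_\<beta>: assumes "x \<in> X" shows "k n (\<beta> (Suc n) x) = x (l n)"
proof -
  have "k n (\<beta> (Suc n) x) = bond p (l n) (l (Suc n) - l n) (x (l n + (l (Suc n) - l n)))"
    using k_r[OF X_carrier[OF assms]] l_less[of n] by (simp add: \<beta>_def)
  then show ?thesis using bond_inv_limit[OF assms] by simp
qed

lemma f_\<beta>: "x \<in> X \<Longrightarrow> f n (\<beta> (Suc n) x) = \<beta> n x"
  using f_eq[OF \<beta>_le] k_\<beta> by (simp add: \<beta>_def)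

lemma coordinate_\<beta>:
  assumes "x \<in> X" "m \<le> l n"
  shows "x m = bond p m (l n - m) (k n (\<beta> (Suc n) x))"
  using k_\<beta>[OF assms(1), of n] bond_inv_limit[OF assms(1), of m "l n - m"] assms(2) by simp

lemma \<beta>_eq_mono:
  assumes "x \<in> X" "y \<in> X" "\<beta> n x = \<beta> n y" "m \<le> n"
  shows "\<beta> m x = \<beta> m y"
  using assms(4,3)
proof (induction n rule: dec_induct)
  case (step n)
  then show ?case using f_\<beta>[OF assms(1), of n] f_\<beta>[OF assms(2), of n] by simp
qed

text \<open>\<open>k n\<close> recovers \<open>x (l n)\<close> from
  \<open>\<beta> (Suc n) x\<close>, and the coordinates up to \<open>n \<le> l n\<close> are images
  of it under bonding maps.\<close>

lemma \<beta>_determines: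
  assumes "x \<in> X" "y \<in> X" "\<beta> (Suc n) x = \<beta> (Suc n) y" "m \<le> n"
  shows "x m = y m"
proof -
  have "m \<le> l n" using assms(4) l_ge[of n] by linarith
  then show ?thesis using coordinate_\<beta>[OF assms(1)] coordinate_\<beta>[OF assms(2)] assms(3) by metis
qed

lemma \<beta>_separates:
  assumes "x \<in> X" "y \<in> X" "\<And>n. \<beta> n x = \<beta> n y"
  shows "x = y"
  using \<beta>_determines[OF assms(1,2) assms(3)] by blast

lemma coordinate_onto:
  assumes "v \<in> carrier (A m)"
  shows "\<exists>x\<in>X. x m = v"
proof -
  have "\<exists>y. \<forall>i. (y i \<in> carrier (A (m + i)) \<and> (i = 0 \<longrightarrow> y i = v)) \<and> p (m + i) (y (Suc i)) = y i"
  proof (rule dependent_nat_choice[where P = "\<lambda>i y. y \<in> carrier (A (m + i)) \<and> (i = 0 \<longrightarrow> y = v)"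
        and Q = "\<lambda>i y y'. p (m + i) y' = y"])
    show "\<exists>y. y \<in> carrier (A (m + 0)) \<and> (0 = 0 \<longrightarrow> y = v)" using assms by auto
    fix y i assume "y \<in> carrier (A (m + i)) \<and> (i = 0 \<longrightarrow> y = v)"
    then obtain y' where "y' \<in> carrier (A (Suc (m + i)))" "p (m + i) y' = y"
      using Epi_onto[OF p_Epi lin lin] by blast
    then show "\<exists>y'. (y' \<in> carrier (A (m + Suc i)) \<and> (Suc i = 0 \<longrightarrow> y' = v)) \<and> p (m + i) y' = y"
      by auto
  qed
  then obtain y where y: "\<And>i. y i \<in> carrier (A (m + i))" "y 0 = v" "\<And>i. p (m + i) (y (Suc i)) = y i"
    by blast
  \<comment> \<open>Above \<open>m\<close> the thread is chosen, below \<open>m\<close> it is forced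
    by the bonding maps.\<close>
  define x where "x n = (if m \<le> n then y (n - m) else bond p n (m - n) v)" for n
  have "x n \<in> carrier (A n)" for n
    using y(1)[of "n - m"] bond_carrier[of p A v n "m - n"] p_Epi assms by (auto simp: x_def)
  moreover have "p n (x (Suc n)) = x n" for n
  proof (cases "m \<le> n")
    case True
    then show ?thesis using y(3)[of "n - m"] by (simp add: x_def Suc_diff_le)
  next
    case False
    \<comment> \<open>\<open>bond\<close> grows at its upper end by definition; here a map is added
      at the lower end.\<close>
    have sh: "p n (bond p (Suc n) i u) = bond p n (Suc i) u" for i u
      by (induction i arbitrary: u) auto
    from False obtain i where i: "m = Suc n + i" by (metis less_iff_Suc_add not_le add_Suc)
    show ?thesis
    proof (cases i)
      case 0
      then show ?thesis using i y by (simp add: x_def)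
    next
      case (Suc j)
      then show ?thesis using i sh[of "Suc j" v] by (simp add: x_def)
    qed
  qed
  ultimately have "x \<in> X" by (simp add: inv_limit_def)
  moreover have "x m = v" using y by (simp add: x_def)
  ultimately show ?thesis by blast
qed

lemma \<beta>_onto:
  assumes "v \<le> N n"
  shows "\<exists>x\<in>X. \<beta> n x = v"
proof -
  obtain u where "u \<in> carrier (A (l n))" "r n u = v"
    using Epi_onto[OF r_Epi lin linear_graph_path, of v n] assms by auto
  then show ?thesis using coordinate_onto by (metis \<beta>_def)
qed

text \<open>Each epimorphism on the limit factors through some \<open>A m\<close>, hence by
  \<open>k m\<close> through the path of level \<open>Suc m\<close>. So it suffices to test the maps
  \<open>\<beta> n\<close>.\<close>

lemma limit_adj_iff:
  "(x, y) \<in> limit_adj A p \<longleftrightarrow> x \<in> X \<and> y \<in> X \<and> (\<forall>n. near 1 (\<beta> n x) (\<beta> n y))"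
proof
  assume xy: "(x, y) \<in> limit_adj A p"
  then have X: "x \<in> X" "y \<in> X" by (auto simp: limit_adj_def)
  have "near 1 (\<beta> n x) (\<beta> n y)" for n
  proof -
    have "compose X (r n) (\<lambda>x. x (l n)) \<in> limit_Epi A p (path_graph (N n))"
      using r_Epi unfolding limit_Epi_def by blast
    then have "(compose X (r n) (\<lambda>x. x (l n)) x, compose X (r n) (\<lambda>x. x (l n)) y) \<in> adj (path_graph (N n))"
      using xy linear_graph_path unfolding limit_adj_def by blast
    then show ?thesis using X by (simp add: compose_def adj_path_graph \<beta>_def)
  qed
  with X show "x \<in> X \<and> y \<in> X \<and> (\<forall>n. near 1 (\<beta> n x) (\<beta> n y))" by blast
next
  assume xy: "x \<in> X \<and> y \<in> X \<and> (\<forall>n. near 1 (\<beta> n x) (\<beta> n y))"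
  have "(\<phi> x, \<phi> y) \<in> adj B" if \<phi>: "\<phi> \<in> limit_Epi A p B" for B \<phi>
  proof -
    obtain h m where h: "\<phi> = compose X h (\<lambda>x. x m)" "h \<in> Epi (A m) B"
      using \<phi> unfolding limit_Epi_def by blast
    have "(\<beta> (Suc m) x, \<beta> (Suc m) y) \<in> adj (path_graph (N (Suc m)))"
      using xy \<beta>_le by (simp add: adj_path_graph)
    from k_adj[OF this] have "(x (m + (l m - m)), y (m + (l m - m))) \<in> adj (A (m + (l m - m)))"
      using xy l_ge[of m] by (simp add: k_\<beta>)
    from bond_adj[OF p_Epi this] have "(x m, y m) \<in> adj (A m)" 
      using xy bond_inv_limit[of x A p m "l m - m"] bond_inv_limit[of y A p m "l m - m"] by simp
    from Epi_adj[OF h(2) this] show ?thesis using xy by (simp add: h(1) compose_def)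
  qed
  with xy show "(x, y) \<in> limit_adj A p" unfolding limit_adj_def by blast
qed

text \<open>Compactness by a diagonal argument: each coordinate takes finitely many values, so it is
  constant along a subsequence.\<close>

lemma convergent_subsequence:
  fixes u :: "nat \<Rightarrow> nat \<Rightarrow> nat"
  assumes u: "\<And>i. u i \<in> X"
  obtains x s where "x \<in> X" "strict_mono s" "\<And>n. \<forall>\<^sub>F i in sequentially. \<beta> n (u (s i)) = \<beta> n x"
proof -
  define P where "P n s \<longleftrightarrow> (\<exists>c. \<forall>i. u (s i) n = c)" for n and s :: "nat \<Rightarrow> nat"
  interpret subseqs P
  proof
    fix n and s :: "nat \<Rightarrow> nat" assume s: "strict_mono s"
    have "finite ((\<lambda>i. u (s i) n) ` UNIV)"
      using u X_carrier linear_graph_finite[OF lin[of n]] by (auto intro: finite_subset)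
    then obtain c where "infinite {i \<in> UNIV. u (s i) n = c}"
      using pigeonhole_infinite[of UNIV "\<lambda>i. u (s i) n"] by (auto simp: infinite_UNIV_nat)
    then obtain q :: "nat \<Rightarrow> nat" where "strict_mono q" "\<And>i. q i \<in> {i \<in> UNIV. u (s i) n = c}"
      using infinite_enumerate by blast
    then show "\<exists>q. strict_mono q \<and> P n (s \<circ> q)" unfolding P_def by auto
  qed
  have "P n (diagseq \<circ> (+) (Suc n))" for n
    by (rule diagseq_holds) (auto simp: P_def)
  then have "\<exists>x. \<forall>n i. u (diagseq (Suc n + i)) n = x n" unfolding P_def by (intro choice) auto
  then obtain x where x: "\<And>n i. u (diagseq (Suc n + i)) n = x n" by blast
  have ev: "u (diagseq i) n = x n" if "Suc n \<le> i" for n i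
    using x[of n "i - Suc n"] that by simp
  have "x \<in> X" unfolding inv_limit_def
  proof (intro CollectI allI)
    fix n
    let ?y = "u (diagseq (Suc (Suc n)))"
    have "?y n \<in> carrier (A n)" "p n (?y (Suc n)) = ?y n" using u unfolding inv_limit_def by blast+
    then show "x n \<in> carrier (A n) \<and> p n (x (Suc n)) = x n"
      using ev[of n "Suc (Suc n)"] ev[of "Suc n" "Suc (Suc n)"] by simp
  qed
  moreover have "\<forall>\<^sub>F i in sequentially. \<beta> n (u (diagseq i)) = \<beta> n x" for n
    using ev[of "l n"] by (auto simp: eventually_sequentially \<beta>_def intro!: exI[of _ "Suc (l n)"])
  ultimately show ?thesis using that subseq_diagseq by blast
qed

lemma topspace_limit: "topspace (inv_limit_topology A p) = X"
proof -
  have "X \<subseteq> Pi\<^sub>E UNIV (\<lambda>n. carrier (A n))" by (auto simp: inv_limit_def)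
  then show ?thesis by (simp add: inv_limit_topology_def Int_absorb1)
qed

text \<open>The fibres of the maps \<open>\<beta> n\<close> form a base: a basic open set restricts
  finitely many coordinates, and a high enough level determines all of them.\<close>

lemma openin_limit:
  "openin (inv_limit_topology A p) U \<longleftrightarrow>
     U \<subseteq> X \<and> (\<forall>x\<in>U. \<exists>n. \<forall>y\<in>X. \<beta> n y = \<beta> n x \<longrightarrow> y \<in> U)"
proof
  let ?P = "product_topology (\<lambda>n. discrete_topology (carrier (A n))) UNIV"
  assume "openin (inv_limit_topology A p) U"
  then obtain T where T: "openin ?P T" "U = T \<inter> X"
    unfolding inv_limit_topology_def openin_subtopology by blast
  have "\<exists>n. \<forall>y\<in>X. \<beta> n y = \<beta> n x \<longrightarrow> y \<in> U" if "x \<in> U" for x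
  proof -
    have x: "x \<in> T" "x \<in> X" using that T by auto
    obtain V where V: "finite {i \<in> UNIV. V i \<noteq> topspace (discrete_topology (carrier (A i)))}"
      "x \<in> Pi\<^sub>E UNIV V" "Pi\<^sub>E UNIV V \<subseteq> T"
      using T(1)[unfolded openin_product_topology_alt, rule_format, OF x(1)] by blast
    then obtain m where m: "\<And>i. V i \<noteq> carrier (A i) \<Longrightarrow> i \<le> m"
      using finite_nat_set_iff_bounded_le by auto
    have "y \<in> U" if y: "y \<in> X" "\<beta> (Suc m) y = \<beta> (Suc m) x" for y
    proof -
      have "y i \<in> V i" for i
      proof (cases "i \<le> m")
        case True
        then show ?thesis using \<beta>_determines[OF y(1) x(2) y(2), of i] V(2) by auto
      next
        case False
        then show ?thesis using m[of i] X_carrier[OF y(1)] by auto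
      qed
      then have "y \<in> Pi\<^sub>E UNIV V" by auto
      then show ?thesis using V(3) y T(2) by blast
    qed
    then show ?thesis by blast
  qed
  then show "U \<subseteq> X \<and> (\<forall>x\<in>U. \<exists>n. \<forall>y\<in>X. \<beta> n y = \<beta> n x \<longrightarrow> y \<in> U)" using T by blast
next
  let ?P = "product_topology (\<lambda>n. discrete_topology (carrier (A n))) UNIV"
  assume U: "U \<subseteq> X \<and> (\<forall>x\<in>U. \<exists>n. \<forall>y\<in>X. \<beta> n y = \<beta> n x \<longrightarrow> y \<in> U)"
  show "openin (inv_limit_topology A p) U"
  proof (subst openin_subopen, intro ballI)
    fix x assume x: "x \<in> U"
    then obtain n where n: "\<forall>y\<in>X. \<beta> n y = \<beta> n x \<longrightarrow> y \<in> U" using U by blast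
    let ?T = "{y \<in> topspace ?P. y (l n) \<in> {x (l n)}}"
    have "openin ?P ?T"
      by (rule openin_continuous_map_preimage[OF continuous_map_product_projection])
        (use x U X_carrier in auto)
    then have "openin (inv_limit_topology A p) (?T \<inter> X)"
      unfolding inv_limit_topology_def by (rule openin_subtopology_Int)
    moreover have "x \<in> ?T \<inter> X" using x U X_carrier by (auto simp: topspace_product_topology)
    moreover have "?T \<inter> X \<subseteq> U" using n by (auto simp: \<beta>_def)
    ultimately show "\<exists>T. openin (inv_limit_topology A p) T \<and> x \<in> T \<and> T \<subseteq> U" by blast
  qed
qed

subsection \<open>The topology of the limit and of the pseudoarc\<close>

definition conv :: "(nat \<Rightarrow> nat \<Rightarrow> nat) \<Rightarrow> (nat \<Rightarrow> nat) \<Rightarrow> bool" where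
  "conv u x \<longleftrightarrow> (\<forall>n. \<forall>\<^sub>F i in sequentially. \<beta> n (u i) = \<beta> n x)"

lemma conv_subseq: "conv u x \<Longrightarrow> strict_mono s \<Longrightarrow> conv (\<lambda>i. u (s i)) x"
  unfolding conv_def using eventually_subseq by blast

lemma convI:
  assumes "\<And>i. u i \<in> X" "x \<in> X" "\<And>i. \<beta> i (u i) = \<beta> i x"
  shows "conv u x"
  unfolding conv_def eventually_sequentially
proof
  fix n
  show "\<exists>M. \<forall>i\<ge>M. \<beta> n (u i) = \<beta> n x"
    using \<beta>_eq_mono[OF assms(1,2,3)] by blast
qed

lemma conv_compact:
  fixes u :: "nat \<Rightarrow> nat \<Rightarrow> nat"
  assumes "\<And>i. u i \<in> X"
  obtains x s where "x \<in> X" "strict_mono s" "conv (\<lambda>i. u (s i)) x"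
proof -
  obtain x s where "x \<in> X" "strict_mono s" "\<And>n. \<forall>\<^sub>F i in sequentially. \<beta> n (u (s i)) = \<beta> n x"
    by (rule convergent_subsequence[of u, OF assms]) blast
  then show ?thesis using that unfolding conv_def by blast
qed

lemma conv_compact3:
  fixes u v w :: "nat \<Rightarrow> nat \<Rightarrow> nat"
  assumes u: "\<And>i. u i \<in> X" and v: "\<And>i. v i \<in> X" and w: "\<And>i. w i \<in> X"
  obtains x y z s where "x \<in> X" "y \<in> X" "z \<in> X" "strict_mono s"
    "conv (\<lambda>i. u (s i)) x" "conv (\<lambda>i. v (s i)) y" "conv (\<lambda>i. w (s i)) z"
proof -
  obtain x s1 where 1: "x \<in> X" "strict_mono s1" "conv (\<lambda>i. u (s1 i)) x"
    using conv_compact[of u] u by blast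
  obtain y s2 where 2: "y \<in> X" "strict_mono s2" "conv (\<lambda>i. v (s1 (s2 i))) y"
    using conv_compact[of "\<lambda>i. v (s1 i)"] v by blast
  obtain z s3 where 3: "z \<in> X" "strict_mono s3" "conv (\<lambda>i. w (s1 (s2 (s3 i)))) z"
    using conv_compact[of "\<lambda>i. w (s1 (s2 i))"] w by blast
  have "strict_mono (\<lambda>i. s2 (s3 i))" using strict_mono_o[OF 2(2) 3(2)] by (simp add: o_def)
  then have "conv (\<lambda>i. u (s1 (s2 (s3 i)))) x" using conv_subseq[OF 1(3)] by blast
  moreover have "conv (\<lambda>i. v (s1 (s2 (s3 i)))) y" using conv_subseq[OF 2(3) 3(2)] by blast
  moreover have "strict_mono (\<lambda>i. s1 (s2 (s3 i)))"
    using strict_mono_o[OF 1(2) strict_mono_o[OF 2(2) 3(2)]] by (simp add: o_def)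
  ultimately show ?thesis using that 1(1) 2(1) 3(1,3) by blast
qed

lemma conv_at:
  assumes "conv u x" "conv v y"
  obtains i where "M \<le> i" "\<beta> n (u i) = \<beta> n x" "\<beta> m (v i) = \<beta> m y"
proof -
  have "\<forall>\<^sub>F i in sequentially. M \<le> i \<and> \<beta> n (u i) = \<beta> n x \<and> \<beta> m (v i) = \<beta> m y"
    using assms unfolding conv_def by (intro eventually_conj eventually_ge_at_top) auto
  then show ?thesis using that eventually_happens'[OF sequentially_bot] by blast
qed

section \<open>Contraction, adjacency and its classes\<close>

lemma g_le: "x \<le> N (Suc n) \<Longrightarrow> g n x \<le> N n"
  using zigzag[of n] unfolding zigzag_def by blast

lemma f_contracting: "contracting (N (Suc n)) (f n)" and g_contracting: "contracting (N (Suc n)) (g n)"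
  using zigzag[of n] unfolding zigzag_def by blast+

lemma linked_near: "w \<le> N (Suc (Suc n)) \<Longrightarrow> near 1 (f n (f (Suc n) w)) (g n (g (Suc n) w))"
  using linked[of n] unfolding linked_def by blast

lemma near_mono: "near i u v \<Longrightarrow> i \<le> j \<Longrightarrow> near j u v"
  unfolding near_def by linarith

lemma near_trans: "near i u v \<Longrightarrow> near j v w \<Longrightarrow> near (i + j) u w"
  unfolding near_def by linarith

lemma \<beta>_contract:
  assumes "x \<in> X" "y \<in> X" "near 5 (\<beta> (Suc n) x) (\<beta> (Suc n) y)"
  shows "near 1 (\<beta> n x) (\<beta> n y)"
  using contractingD[OF f_contracting \<beta>_le[OF assms(1)] \<beta>_le[OF assms(2)] assms(3)]
  by (simp add: f_\<beta>[OF assms(1)] f_\<beta>[OF assms(2)])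

lemma \<beta>_near_mono:
  assumes "x \<in> X" "y \<in> X" "near 1 (\<beta> n x) (\<beta> n y)" "m \<le> n"
  shows "near 1 (\<beta> m x) (\<beta> m y)"
  using assms(4,3)
proof (induction n rule: dec_induct)
  case (step n)
  have "near 5 (\<beta> (Suc n) x) (\<beta> (Suc n) y)" using near_mono[OF step.prems] by simp
  then show ?case using step.IH \<beta>_contract[OF assms(1,2)] by blast
qed

text \<open>\<open>limit_adj\<close> stripped of membership in \<open>X\<close>, by
  \<open>limit_adj_iff\<close>.\<close>

definition R :: "(nat \<Rightarrow> nat) \<Rightarrow> (nat \<Rightarrow> nat) \<Rightarrow> bool" where
  "R x y \<longleftrightarrow> (\<forall>n. near 1 (\<beta> n x) (\<beta> n y))"

lemma R_refl: "R x x"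
  by (simp add: R_def)

lemma R_sym: "R x y \<Longrightarrow> R y x"
  using near_sym by (auto simp: R_def)

text \<open>Each level is the contracting image of the next one, so closeness up to \<open>5\<close>
  at every level is already adjacency. This absorbs the errors in \<open>R_trans\<close> and
  \<open>\<Sigma>_compat\<close>.\<close>

lemma RI_near:
  assumes "x \<in> X" "y \<in> X" "\<And>n. near 5 (\<beta> n x) (\<beta> n y)"
  shows "R x y"
  unfolding R_def using \<beta>_contract[OF assms(1,2) assms(3)] by blast

lemma R_trans:
  assumes "x \<in> X" "z \<in> X" "R x y" "R y z"
  shows "R x z"
proof (rule RI_near[OF assms(1,2)])
  fix n
  have "near (1 + 1) (\<beta> n x) (\<beta> n z)"
    using assms(3,4) near_trans unfolding R_def by blast
  then show "near 5 (\<beta> n x) (\<beta> n z)" by (rule near_mono) simp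
qed

abbreviation pr' :: "(nat \<Rightarrow> nat) \<Rightarrow> (nat \<Rightarrow> nat) set" where
  "pr' \<equiv> pr A p"

lemma pr_eq_iff:
  assumes "x \<in> X" "y \<in> X"
  shows "pr' x = pr' y \<longleftrightarrow> R x y"
proof -
  have *: "z \<in> pr' x \<longleftrightarrow> z \<in> X \<and> R x z" if "x \<in> X" for x z
    using that by (auto simp: pr_def limit_adj_iff R_def)
  show ?thesis
  proof
    assume "pr' x = pr' y"
    moreover have "y \<in> pr' y" using * assms R_refl by blast
    ultimately show "R x y" using *[OF assms(1)] by blast
  next
    assume "R x y"
    then show "pr' x = pr' y" using *[OF assms(1)] *[OF assms(2)] R_trans R_sym assms by blast
  qed
qed

text \<open>Three distinct points are told apart at a common level, but a path has no three distinct
  pairwise adjacent vertices.\<close>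

lemma R_class_le2:
  assumes "x \<in> X" "y \<in> X" "z \<in> X" "R x y" "R y z" "R x z"
  shows "x = y \<or> y = z \<or> x = z"
proof (rule ccontr)
  assume "\<not> (x = y \<or> y = z \<or> x = z)"
  then obtain n1 n2 n3 where n: "\<beta> n1 x \<noteq> \<beta> n1 y" "\<beta> n2 y \<noteq> \<beta> n2 z" "\<beta> n3 x \<noteq> \<beta> n3 z"
    using \<beta>_separates assms(1-3) by metis
  define n where "n = n1 + n2 + n3"
  have "\<beta> n x \<noteq> \<beta> n y" "\<beta> n y \<noteq> \<beta> n z" "\<beta> n x \<noteq> \<beta> n z"
    using \<beta>_eq_mono[of x y n n1] \<beta>_eq_mono[of y z n n2] \<beta>_eq_mono[of x z n n3] n assms(1-3)
    by (auto simp: n_def)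
  moreover have "near 1 (\<beta> n x) (\<beta> n y)" "near 1 (\<beta> n y) (\<beta> n z)" "near 1 (\<beta> n x) (\<beta> n z)"
    using assms(4-6) by (auto simp: R_def)
  ultimately show False unfolding near_def by linarith
qed

lemma topspace_pseudoarc: "topspace (pseudoarc A p) = pr' ` X"
  by (simp add: pseudoarc_def topspace_quotient_topology topspace_limit)

lemma openin_pseudoarc:
  "openin (pseudoarc A p) U \<longleftrightarrow>
     U \<subseteq> pr' ` X \<and> (\<forall>x\<in>X. pr' x \<in> U \<longrightarrow> (\<exists>n. \<forall>y\<in>X. \<beta> n y = \<beta> n x \<longrightarrow> pr' y \<in> U))"
proof -
  have "openin (inv_limit_topology A p) {x \<in> X. pr' x \<in> U} \<longleftrightarrow>
      (\<forall>x\<in>X. pr' x \<in> U \<longrightarrow> (\<exists>n. \<forall>y\<in>X. \<beta> n y = \<beta> n x \<longrightarrow> pr' y \<in> U))"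
    unfolding openin_limit by blast
  then show ?thesis by (simp add: pseudoarc_def openin_quotient_topology topspace_limit)
qed

section \<open>Closed graphs and continuity on the pseudoarc\<close>

lemma open_pseudoarcD:
  assumes "openin (pseudoarc A p) U" "x \<in> X" "pr' x \<in> U"
  shows "\<exists>n. \<forall>y\<in>X. \<beta> n y = \<beta> n x \<longrightarrow> pr' y \<in> U"
  using assms unfolding openin_pseudoarc by blast

text \<open>If \<open>h (pr' x)\<close> differed from \<open>pr' y\<close>, some level
  \<open>m\<close> would separate its representative from \<open>y\<close>. An open neighbourhood of
  \<open>h (pr' x)\<close> would then miss \<open>pr' (v i)\<close> for all large
  \<open>i\<close>.\<close>

lemma continuous_map_closed_graph:
  assumes h: "continuous_map (pseudoarc A p) (pseudoarc A p) h"
    and u: "\<And>i. u i \<in> X" "x \<in> X" "conv u x" and v: "\<And>i. v i \<in> X" "y \<in> X" "conv v y"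
    and huv: "\<And>i. h (pr' (u i)) = pr' (v i)"
  shows "h (pr' x) = pr' y"
proof (rule ccontr)
  assume ne: "h (pr' x) \<noteq> pr' y"
  have "h (pr' x) \<in> pr' ` X"
    using continuous_map_image_subset_topspace[OF h] u(2) topspace_pseudoarc by blast
  then obtain y' where y': "y' \<in> X" "h (pr' x) = pr' y'" by blast
  with ne v(2) have "\<not> R y y'" using pr_eq_iff by metis
  then obtain m where m: "\<not> near 1 (\<beta> m y) (\<beta> m y')" by (auto simp: R_def)
  \<comment> \<open>The complement of the image of a fibre of \<open>\<beta> m\<close>. That image
    is closed because the fibre is compact and adjacency passes to limits.\<close>
  define U where "U = {c \<in> pr' ` X. \<forall>w\<in>X. pr' w = c \<longrightarrow> \<beta> m w \<noteq> \<beta> m y}"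
  have "openin (pseudoarc A p) U" unfolding openin_pseudoarc
  proof (intro conjI ballI impI)
    show "U \<subseteq> pr' ` X" by (auto simp: U_def)
    fix z assume z: "z \<in> X" "pr' z \<in> U"
    show "\<exists>n. \<forall>y\<in>X. \<beta> n y = \<beta> n z \<longrightarrow> pr' y \<in> U"
    proof (rule ccontr)
      assume "\<not> ?thesis"
      then have "\<forall>n. \<exists>q. q \<in> X \<and> \<beta> n q = \<beta> n z \<and> pr' q \<notin> U" by blast
      then obtain q where q: "\<And>n. q n \<in> X" "\<And>n. \<beta> n (q n) = \<beta> n z" "\<And>n. pr' (q n) \<notin> U"
        by metis
      have "\<forall>n. \<exists>w. w \<in> X \<and> pr' w = pr' (q n) \<and> \<beta> m w = \<beta> m y"
        using q(1,3) unfolding U_def by blast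
      then obtain w where w: "\<And>n. w n \<in> X" "\<And>n. pr' (w n) = pr' (q n)" "\<And>n. \<beta> m (w n) = \<beta> m y"
        by metis
      obtain w0 s where s: "w0 \<in> X" "strict_mono s" "conv (\<lambda>i. w (s i)) w0"
        using conv_compact[of w] w(1) by blast
      have cq: "conv (\<lambda>i. q (s i)) z" using conv_subseq[OF convI[OF q(1) z(1) q(2)] s(2)] .
      have "near 1 (\<beta> n w0) (\<beta> n z)" for n
      proof -
        obtain i where "\<beta> n (w (s i)) = \<beta> n w0" "\<beta> n (q (s i)) = \<beta> n z"
          using conv_at[OF s(3) cq, of 0 n n] by blast
        moreover have "R (w (s i)) (q (s i))" using w(1,2) q(1) pr_eq_iff by blast
        ultimately show ?thesis unfolding R_def by metis
      qed
      then have "pr' w0 = pr' z" using s(1) z(1) pr_eq_iff by (auto simp: R_def)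
      moreover obtain i where "\<beta> m (w (s i)) = \<beta> m w0"
        using conv_at[OF s(3) s(3), of 0 m m] by blast
      ultimately show False using z(2) s(1) w(3) unfolding U_def by (metis (mono_tags, lifting) mem_Collect_eq)
    qed
  qed
  then have op: "openin (pseudoarc A p) {c \<in> topspace (pseudoarc A p). h c \<in> U}"
    by (rule openin_continuous_map_preimage[OF h])
  have "pr' y' \<in> U"
  proof -
    have "\<beta> m w \<noteq> \<beta> m y" if "w \<in> X" "pr' w = pr' y'" for w
    proof -
      have "R w y'" using that y'(1) pr_eq_iff by blast
      then show ?thesis using m unfolding R_def by metis
    qed
    then show ?thesis using y'(1) by (auto simp: U_def)
  qed
  then have "pr' x \<in> {c \<in> topspace (pseudoarc A p). h c \<in> U}"
    using y'(2) u(2) topspace_pseudoarc by auto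
  from open_pseudoarcD[OF op u(2) this] obtain n where
    n: "\<forall>z\<in>X. \<beta> n z = \<beta> n x \<longrightarrow> pr' z \<in> {c \<in> topspace (pseudoarc A p). h c \<in> U}" ..
  obtain i where i: "\<beta> n (u i) = \<beta> n x" "\<beta> m (v i) = \<beta> m y"
    using conv_at[OF u(3) v(3), of 0 n m] by blast
  have "pr' (v i) \<in> U" using n[rule_format, OF u(1) i(1)] huv[of i] by simp
  then show False using i(2) v(1) unfolding U_def by blast
qed

text \<open>Closed graph theorem for a compact space, with \<open>S\<close> a possibly multivalued
  lift of \<open>F\<close>. If points near \<open>x\<close> were mapped outside \<open>U\<close>,
  their \<open>S\<close>-partners would accumulate at a partner of \<open>x\<close>, which lies over
  a point of \<open>U\<close>.\<close>

lemma closed_graph_continuous_map: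
  assumes S_X: "\<And>x y. S x y \<Longrightarrow> x \<in> X \<and> y \<in> X"
    and total: "\<And>x. x \<in> X \<Longrightarrow> \<exists>y. S x y"
    and closed: "\<And>u v x y. (\<And>i. S (u i) (v i)) \<Longrightarrow> x \<in> X \<Longrightarrow> y \<in> X \<Longrightarrow> conv u x \<Longrightarrow> conv v y \<Longrightarrow> S x y"
    and F: "\<And>x y. S x y \<Longrightarrow> F (pr' x) = pr' y"
  shows "continuous_map (pseudoarc A p) (pseudoarc A p) F"
  unfolding continuous_map_def
proof (intro conjI allI impI)
  show "F \<in> topspace (pseudoarc A p) \<rightarrow> topspace (pseudoarc A p)"
  proof
    fix c assume "c \<in> topspace (pseudoarc A p)"
    then obtain x where x: "x \<in> X" "c = pr' x" by (auto simp: topspace_pseudoarc)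
    with total obtain y where "S x y" by blast
    then show "F c \<in> topspace (pseudoarc A p)" using F S_X x by (auto simp: topspace_pseudoarc)
  qed
next
  fix U assume U: "openin (pseudoarc A p) U"
  show "openin (pseudoarc A p) {c \<in> topspace (pseudoarc A p). F c \<in> U}"
    unfolding openin_pseudoarc
  proof (intro conjI ballI impI)
    show "{c \<in> topspace (pseudoarc A p). F c \<in> U} \<subseteq> pr' ` X" by (auto simp: topspace_pseudoarc)
    fix x assume x: "x \<in> X" "pr' x \<in> {c \<in> topspace (pseudoarc A p). F c \<in> U}"
    show "\<exists>n. \<forall>z\<in>X. \<beta> n z = \<beta> n x \<longrightarrow> pr' z \<in> {c \<in> topspace (pseudoarc A p). F c \<in> U}"
    proof (rule ccontr)
      assume "\<not> ?thesis"
      then have "\<forall>n. \<exists>q. q \<in> X \<and> \<beta> n q = \<beta> n x \<and> F (pr' q) \<notin> U"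
        by (auto simp: topspace_pseudoarc)
      then obtain q where q: "\<And>n. q n \<in> X" "\<And>n. \<beta> n (q n) = \<beta> n x" "\<And>n. F (pr' (q n)) \<notin> U"
        by metis
      have "\<forall>n. \<exists>w. S (q n) w" using total q(1) by blast
      from choice[OF this] obtain w where "\<forall>n. S (q n) (w n)" ..
      then have w: "\<And>n. S (q n) (w n)" by blast
      then have wX: "\<And>n. w n \<in> X" using S_X by blast
      obtain y s where s: "y \<in> X" "strict_mono s" "conv (\<lambda>i. w (s i)) y"
        using conv_compact[of w] wX by blast
      have cq: "conv (\<lambda>i. q (s i)) x" using conv_subseq[OF convI[OF q(1) x(1) q(2)] s(2)] .
      have "S x y" by (rule closed[OF w x(1) s(1) cq s(3)])
      then have "pr' y \<in> U" using F x(2) by auto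
      from open_pseudoarcD[OF U s(1) this] obtain m where
        m: "\<forall>z\<in>X. \<beta> m z = \<beta> m y \<longrightarrow> pr' z \<in> U" ..
      obtain i where "\<beta> m (w (s i)) = \<beta> m y" using conv_at[OF s(3) s(3), of 0 m m] by blast
      then have "pr' (w (s i)) \<in> U" using m wX by blast
      then show False using F[OF w] q(3) by metis
    qed
  qed
qed

text \<open>The two directions of \<open>compat\<close> make \<open>S\<close> and its converse
  single-valued on classes. Both have closed graphs, so they induce mutually inverse continuous
  maps.\<close>

lemma closed_relation_Homeo:
  assumes S_X: "\<And>x y. S x y \<Longrightarrow> x \<in> X \<and> y \<in> X"
    and total: "\<And>x. x \<in> X \<Longrightarrow> \<exists>y. S x y" "\<And>y. y \<in> X \<Longrightarrow> \<exists>x. S x y"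
    and closed: "\<And>u v x y. (\<And>i. S (u i) (v i)) \<Longrightarrow> x \<in> X \<Longrightarrow> y \<in> X \<Longrightarrow> conv u x \<Longrightarrow> conv v y \<Longrightarrow> S x y"
    and compat: "\<And>x y x' y'. S x y \<Longrightarrow> S x' y' \<Longrightarrow> R x x' \<longleftrightarrow> R y y'"
  obtains \<sigma> where "\<sigma> \<in> carrier (Homeo (pseudoarc A p))" "\<And>x y. S x y \<Longrightarrow> \<sigma> (pr' x) = pr' y"
proof -
  let ?P = "pseudoarc A p"
  define F where "F c = (THE d. \<exists>x y. S x y \<and> c = pr' x \<and> d = pr' y)" for c
  define G where "G d = (THE c. \<exists>x y. S x y \<and> c = pr' x \<and> d = pr' y)" for d
  have pr_compat: "pr' x = pr' x' \<longleftrightarrow> pr' y = pr' y'" if "S x y" "S x' y'" for x y x' y'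
    using compat[OF that] pr_eq_iff S_X[OF that(1)] S_X[OF that(2)] by simp
  have F: "F (pr' x) = pr' y" if "S x y" for x y
    unfolding F_def
  proof (rule the_equality)
    show "\<exists>x' y'. S x' y' \<and> pr' x = pr' x' \<and> pr' y = pr' y'" using that by blast
    fix d assume "\<exists>x' y'. S x' y' \<and> pr' x = pr' x' \<and> d = pr' y'"
    then show "d = pr' y" using pr_compat[OF that] by blast
  qed
  have G: "G (pr' y) = pr' x" if "S x y" for x y
    unfolding G_def
  proof (rule the_equality)
    show "\<exists>x' y'. S x' y' \<and> pr' x = pr' x' \<and> pr' y = pr' y'" using that by blast
    fix d assume "\<exists>x' y'. S x' y' \<and> d = pr' x' \<and> pr' y = pr' y'"
    then show "d = pr' x" using pr_compat[OF that] by blast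
  qed
  have "continuous_map ?P ?P F"
    by (rule closed_graph_continuous_map[where S = S]) (use S_X total closed F in blast)+
  moreover have "continuous_map ?P ?P G"
    by (rule closed_graph_continuous_map[where S = "\<lambda>y x. S x y"]) (use S_X total closed G in blast)+
  moreover have "G (F c) = c" "F (G c) = c" if c: "c \<in> topspace ?P" for c
  proof -
    obtain x where x: "x \<in> X" "c = pr' x" using c by (auto simp: topspace_pseudoarc)
    obtain y where "S x y" using total x by blast
    then show "G (F c) = c" using F G x by simp
    obtain y where "S y x" using total x by blast
    then show "F (G c) = c" using F G x by simp
  qed
  ultimately have "homeomorphic_maps ?P ?P F G" by (simp add: homeomorphic_maps_def)
  then have "homeomorphic_map ?P ?P F" using homeomorphic_map_maps by blast
  then have "homeomorphic_map ?P ?P (restrict F (topspace ?P))"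
    by (rule homeomorphic_map_eq) simp
  then have "restrict F (topspace ?P) \<in> carrier (Homeo ?P)" by (simp add: Homeo_def)
  moreover have "restrict F (topspace ?P) (pr' x) = pr' y" if "S x y" for x y
    using F[OF that] S_X[OF that] by (simp add: topspace_pseudoarc)
  ultimately show ?thesis using that by blast
qed

subsection \<open>The homeomorphism and its slow orbits\<close>

text \<open>For even \<open>n\<close> the condition says that \<open>g n\<close> predicts \<open>y\<close> from \<open>x\<close>, for odd \<open>n\<close> that it predicts
  \<open>x\<close> from \<open>y\<close>; the alternating sequence makes both cases one.\<close>

definition alt :: "(nat \<Rightarrow> nat) \<Rightarrow> (nat \<Rightarrow> nat) \<Rightarrow> nat \<Rightarrow> nat \<Rightarrow> nat" where
  "alt x y n = (if even n then y else x)"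

definition shadows :: "(nat \<Rightarrow> nat) \<Rightarrow> (nat \<Rightarrow> nat) \<Rightarrow> nat \<Rightarrow> bool" where
  "shadows x y n \<longleftrightarrow> near 2 (\<beta> n (alt x y n)) (g n (\<beta> (Suc n) (alt x y (Suc n))))"

definition \<Sigma> :: "(nat \<Rightarrow> nat) \<Rightarrow> (nat \<Rightarrow> nat) \<Rightarrow> bool" where
  "\<Sigma> x y \<longleftrightarrow> x \<in> X \<and> y \<in> X \<and> (\<forall>n. shadows x y n)"

lemma alt_X: "x \<in> X \<Longrightarrow> y \<in> X \<Longrightarrow> alt x y n \<in> X"
  by (simp add: alt_def)

text \<open>The tolerance \<open>2\<close> reproduces itself: \<open>linked\<close> costs
  \<open>1\<close>, and the contracting \<open>g n\<close> reduces the error of the level above to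
  \<open>1\<close>. \<open>alt\<close> has period 2, so two levels up it is the same point that is
  predicted.\<close>

lemma shadows_down:
  assumes X: "x \<in> X" "y \<in> X" and s: "shadows x y (Suc n)"
  shows "shadows x y n"
proof -
  let ?z = "alt x y"
  let ?w = "\<beta> (Suc (Suc n)) (?z (Suc (Suc n)))"
  note zX = alt_X[OF X]
  have zz: "?z (Suc (Suc n)) = ?z n" by (simp add: alt_def)
  have w: "?w \<le> N (Suc (Suc n))" by (rule \<beta>_le[OF zX])
  have "\<beta> n (?z n) = f n (f (Suc n) ?w)"
    using f_\<beta>[OF zX[of n]] by (simp add: zz)
  then have 1: "near 1 (\<beta> n (?z n)) (g n (g (Suc n) ?w))" using linked_near[OF w] by simp
  have "near 5 (g (Suc n) ?w) (\<beta> (Suc n) (?z (Suc n)))"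
    using near_sym[OF s[unfolded shadows_def]] near_mono by fastforce
  then have "near 1 (g n (g (Suc n) ?w)) (g n (\<beta> (Suc n) (?z (Suc n))))"
    by (intro contractingD[OF g_contracting] g_le[OF w] \<beta>_le[OF zX])
  from near_trans[OF 1 this] show ?thesis unfolding shadows_def one_add_one .
qed

lemma shadows_below:
  assumes "x \<in> X" "y \<in> X" "shadows x y n" "m \<le> n"
  shows "shadows x y m"
  using assms(4,3)
proof (induction n rule: dec_induct)
  case (step n)
  then show ?case using shadows_down[OF assms(1,2)] by blast
qed

text \<open>Shadowing at level \<open>h i\<close> implies shadowing at all lower levels. Each level
  involves finitely many coordinates, which are eventually those of the limits.\<close>

lemma \<Sigma>I:
  assumes X: "x \<in> X" "y \<in> X" and c: "conv u x" "conv v y"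
    and s: "\<And>i. u i \<in> X \<and> v i \<in> X \<and> shadows (u i) (v i) (h i)" and h: "\<And>i. i \<le> h i"
  shows "\<Sigma> x y"
  unfolding \<Sigma>_def
proof (intro conjI allI X)
  fix n
  have "\<forall>\<^sub>F i in sequentially. n \<le> i \<and> \<beta> n (u i) = \<beta> n x \<and> \<beta> (Suc n) (u i) = \<beta> (Suc n) x
      \<and> \<beta> n (v i) = \<beta> n y \<and> \<beta> (Suc n) (v i) = \<beta> (Suc n) y"
    using c unfolding conv_def by (intro eventually_conj eventually_ge_at_top) auto
  then obtain i where i: "n \<le> i" "\<beta> n (u i) = \<beta> n x" "\<beta> (Suc n) (u i) = \<beta> (Suc n) x"
      "\<beta> n (v i) = \<beta> n y" "\<beta> (Suc n) (v i) = \<beta> (Suc n) y"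
    using eventually_happens'[OF sequentially_bot] by blast
  have "n \<le> h i" using i(1) h[of i] by simp
  then have "shadows (u i) (v i) n" using shadows_below s by blast
  then show "shadows x y n" using i(2-) by (cases "even n") (simp_all add: shadows_def alt_def)
qed

lemma \<Sigma>_closed:
  assumes "\<And>i. \<Sigma> (u i) (v i)" "x \<in> X" "y \<in> X" "conv u x" "conv v y"
  shows "\<Sigma> x y"
  by (rule \<Sigma>I[OF assms(2-5), of "\<lambda>i. i"]) (use assms(1) in \<open>auto simp: \<Sigma>_def\<close>)

text \<open>For each even level take a point with exactly the predicted coordinate there; a limit of
  such points works at all levels.\<close>

lemma \<Sigma>_total_right:
  assumes "x \<in> X"
  shows "\<exists>y. \<Sigma> x y"
proof -
  have "\<forall>i. \<exists>y. y \<in> X \<and> \<beta> (2 * i) y = g (2 * i) (\<beta> (Suc (2 * i)) x)"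
    using \<beta>_onto g_le \<beta>_le[OF assms] by blast
  from choice[OF this] obtain v where v: "\<And>i. v i \<in> X"
    "\<And>i. \<beta> (2 * i) (v i) = g (2 * i) (\<beta> (Suc (2 * i)) x)" by blast
  obtain y s where y: "y \<in> X" "strict_mono s" "conv (\<lambda>i. v (s i)) y"
    using conv_compact[of v] v(1) by blast
  have "conv (\<lambda>i. x) x" by (simp add: conv_def)
  moreover have "shadows x (v i) (2 * i)" for i by (simp add: shadows_def alt_def v)
  moreover have "i \<le> 2 * s i" for i using seq_suble[OF y(2), of i] by simp
  ultimately have "\<Sigma> x y"
    by (intro \<Sigma>I[OF assms y(1) _ y(3), of _ "\<lambda>i. 2 * s i"]) (use assms v in auto)
  then show ?thesis by blast
qed

text \<open>The same with odd levels, which predict \<open>x\<close> from \<open>y\<close>.\<close>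

lemma \<Sigma>_total_left:
  assumes "y \<in> X"
  shows "\<exists>x. \<Sigma> x y"
proof -
  have "\<forall>i. \<exists>x. x \<in> X \<and> \<beta> (Suc (2 * i)) x = g (Suc (2 * i)) (\<beta> (Suc (Suc (2 * i))) y)"
    using \<beta>_onto g_le \<beta>_le[OF assms] by blast
  from choice[OF this] obtain u where u: "\<And>i. u i \<in> X"
    "\<And>i. \<beta> (Suc (2 * i)) (u i) = g (Suc (2 * i)) (\<beta> (Suc (Suc (2 * i))) y)" by blast
  obtain x s where x: "x \<in> X" "strict_mono s" "conv (\<lambda>i. u (s i)) x"
    using conv_compact[of u] u(1) by blast
  have "conv (\<lambda>i. y) y" by (simp add: conv_def)
  moreover have "shadows (u i) y (Suc (2 * i))" for i by (simp add: shadows_def alt_def u)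
  moreover have "i \<le> Suc (2 * s i)" for i using seq_suble[OF x(2), of i] by simp
  ultimately have "\<Sigma> x y"
    by (intro \<Sigma>I[OF x(1) assms x(3), of _ "\<lambda>i. Suc (2 * s i)"]) (use assms u in auto)
  then show ?thesis by blast
qed

lemma \<Sigma>_near:
  assumes "\<Sigma> x y" "\<Sigma> x' y'" "near 1 (\<beta> (Suc n) (alt x y (Suc n))) (\<beta> (Suc n) (alt x' y' (Suc n)))"
  shows "near 5 (\<beta> n (alt x y n)) (\<beta> n (alt x' y' n))"
proof -
  have X: "alt x y i \<in> X" "alt x' y' i \<in> X" for i using assms(1,2) by (auto simp: \<Sigma>_def alt_def)
  have 1: "near 2 (\<beta> n (alt x y n)) (g n (\<beta> (Suc n) (alt x y (Suc n))))"
    using assms(1) by (simp add: \<Sigma>_def shadows_def)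
  have 2: "near 2 (g n (\<beta> (Suc n) (alt x' y' (Suc n)))) (\<beta> n (alt x' y' n))"
    using assms(2) near_sym by (simp add: \<Sigma>_def shadows_def)
  have 3: "near 1 (g n (\<beta> (Suc n) (alt x y (Suc n)))) (g n (\<beta> (Suc n) (alt x' y' (Suc n))))"
    by (intro contractingD[OF g_contracting] \<beta>_le X near_mono[OF assms(3)]) simp
  show ?thesis using near_trans[OF near_trans[OF 1 3] 2] by simp
qed

text \<open>Adjacency of one pair bounds the distance of the other pair by \<open>5\<close> at every
  second level. The levels in between follow by contraction from the level above.\<close>

lemma \<Sigma>_compat:
  assumes "\<Sigma> x y" "\<Sigma> x' y'"
  shows "R x x' \<longleftrightarrow> R y y'"
proof
  have X: "x \<in> X" "y \<in> X" "x' \<in> X" "y' \<in> X" using assms by (auto simp: \<Sigma>_def)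
  {
    assume R: "R x x'"
    have ev: "near 5 (\<beta> n y) (\<beta> n y')" if "even n" for n
      using \<Sigma>_near[OF assms, of n] R that by (simp add: alt_def R_def)
    show "R y y'"
    proof (rule RI_near[OF X(2,4)])
      fix n
      have "near 1 (\<beta> n y) (\<beta> n y')" if "odd n"
        using \<beta>_contract[OF X(2,4) ev[of "Suc n"]] that by simp
      then show "near 5 (\<beta> n y) (\<beta> n y')" using ev near_mono[of 1 _ _ 5] by (cases "even n") auto
    qed
  next
    assume R: "R y y'"
    have ev: "near 5 (\<beta> n x) (\<beta> n x')" if "odd n" for n
      using \<Sigma>_near[OF assms, of n] R that by (simp add: alt_def R_def)
    show "R x x'"
    proof (rule RI_near[OF X(1,3)])
      fix n
      have "near 1 (\<beta> n x) (\<beta> n x')" if "even n"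
        using \<beta>_contract[OF X(1,3) ev[of "Suc n"]] that by simp
      then show "near 5 (\<beta> n x) (\<beta> n x')" using ev near_mono[of 1 _ _ 5] by (cases "even n") auto
    qed
  }
qed

section \<open>Drift segments and slow orbits\<close>

lemma f_N: "f n (N (Suc n)) = N n" and f_b: "f n (b (Suc n)) = b n" and f_a: "f n (a (Suc n)) = N n"
  and ab: "a (Suc n) \<le> b (Suc n)" and bN: "b (Suc n) \<le> N (Suc n)"
  using zigzag[of n] unfolding zigzag_def by blast+

text \<open>\<open>f n\<close> is a walk taking \<open>b\<close> and \<open>N\<close> of level
  \<open>n + 1\<close> to those of level \<open>n\<close>, so their distance cannot shrink on going
  up.\<close>

lemma gap: "b n + 10 \<le> N n"
proof (induction n)
  case 0
  then show ?case by (simp add: N0 b0)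
next
  case (Suc n)
  have w: "walk (N (Suc n)) (f n)" by (rule contracting_walk[OF f_contracting])
  have "f n (b (Suc n) + i) \<le> b n + i" if "b (Suc n) + i \<le> N (Suc n)" for i using that
  proof (induction i)
    case (Suc i)
    have "near 1 (f n (b (Suc n) + i)) (f n (Suc (b (Suc n) + i)))"
      using walkD[OF w] Suc.prems by simp
    then show ?case using Suc by (simp add: near_def)
  qed (simp add: f_b)
  from this[of "N (Suc n) - b (Suc n)"] have "N n \<le> b n + (N (Suc n) - b (Suc n))"
    using bN[of n] by (simp add: f_N)
  then show ?case using Suc bN[of n] by linarith
qed

text \<open>With \<open>\<beta>_N\<close>: the ends of the final part of each path lie over the ends
  \<open>0\<close> and \<open>10\<close> of level 0.\<close>

lemma \<beta>_b: "x \<in> X \<Longrightarrow> \<beta> n x = b n \<Longrightarrow> \<beta> 0 x = 0"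
proof (induction n)
  case (Suc n)
  then show ?case using f_\<beta>[of x n] f_b[of n] by simp
qed (simp add: b0)

lemma \<beta>_N: "x \<in> X \<Longrightarrow> \<beta> n x = N n \<Longrightarrow> \<beta> 0 x = 10"
proof (induction n)
  case (Suc n)
  then show ?case using f_\<beta>[of x n] f_N[of n] by simp
qed (simp add: N0)

text \<open>One step backwards in time. The odd level \<open>Suc n\<close> predicts
  \<open>\<beta> (Suc n) x\<close> by \<open>q\<close> up to \<open>2\<close>. At \<open>q\<close>
  the map \<open>f n\<close> is two above \<open>\<beta> n y\<close> unless capped, and
  \<open>f n\<close> reduces the prediction error to \<open>1\<close>, so \<open>x\<close> gets
  closer to the top.\<close>

lemma drift_step:
  assumes y: "y \<in> X" and n: "even n" and inside: "a (Suc n) < \<beta> (Suc n) y" "\<beta> (Suc n) y < b (Suc n)"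
    and v: "b n < \<beta> n y"
  obtains x where "\<Sigma> x y" "near 3 (\<beta> n x) (\<beta> n y)"
    "N n \<le> Suc (\<beta> n x) \<or> \<beta> n y < \<beta> n x \<and> a (Suc n) < \<beta> (Suc n) x \<and> \<beta> (Suc n) x < b (Suc n)"
proof -
  obtain x where x: "\<Sigma> x y" using \<Sigma>_total_left[OF y] by blast
  then have xX: "x \<in> X" by (simp add: \<Sigma>_def)
  let ?w = "\<beta> (Suc (Suc n)) y"
  have w: "?w \<le> N (Suc (Suc n))" "f (Suc n) ?w = \<beta> (Suc n) y"
    by (rule \<beta>_le[OF y], rule f_\<beta>[OF y])
  define q where "q = g (Suc n) ?w"
  \<comment> \<open>The locality clause of \<open>linked\<close>: inside the drift segment the
    amalgamation is exact and \<open>q\<close> does not leave the segment.\<close>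
  have q: "a (Suc n) \<le> q" "q \<le> b (Suc n)" "f n (\<beta> (Suc n) y) = g n q"
    using linked[of n] w inside unfolding linked_def q_def by metis+
  have gq: "g n q = \<beta> n y" using q(3) f_\<beta>[OF y] by simp
  then have fq: "f n q = min (N n) (\<beta> n y + 2)"
    using drift[of n] q(1,2) v unfolding drift_def by metis
  have "shadows x y (Suc n)" using x by (simp add: \<Sigma>_def)
  then have xq: "near 2 (\<beta> (Suc n) x) q" using n by (simp add: shadows_def alt_def q_def)
  have qN: "q \<le> N (Suc n)" using q bN[of n] by simp
  have contr: "near 1 (f n i) (f n j)" if "i \<le> N (Suc n)" "j \<le> N (Suc n)" "near 2 i j" for i j
    using contractingD[OF f_contracting that(1,2)] near_mono[OF that(3)] by simp
  have near1: "near 1 (\<beta> n x) (min (N n) (\<beta> n y + 2))"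
    using contr[OF \<beta>_le[OF xX] qN xq] f_\<beta>[OF xX] fq by simp
  have vN: "\<beta> n y \<le> N n" by (rule \<beta>_le[OF y])
  have 3: "near 3 (\<beta> n x) (\<beta> n y)" using near1 vN unfolding near_def by linarith
  \<comment> \<open>Leaving through \<open>b\<close> would force \<open>f n q\<close> down to at
    most \<open>b n + 1\<close>, against the lead of \<open>2\<close>.\<close>
  have "\<beta> (Suc n) x < b (Suc n)"
  proof (rule ccontr)
    assume "\<not> ?thesis"
    then have "near 2 q (b (Suc n))" using q(2) xq unfolding near_def by linarith
    from contr[OF qN bN this] have "f n q \<le> b n + 1" by (simp add: f_b near_def)
    then show False using fq v gap[of n] by linarith
  qed
  \<comment> \<open>Leaving through \<open>a\<close> means that the top is reached up to one
    step.\<close>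
  moreover have "N n \<le> Suc (\<beta> n x)" if "\<not> a (Suc n) < \<beta> (Suc n) x"
  proof -
    have aN: "a (Suc n) \<le> N (Suc n)" using ab[of n] bN[of n] by simp
    have "near 2 (\<beta> (Suc n) x) (a (Suc n))" using that q(1) xq unfolding near_def by linarith
    from contr[OF \<beta>_le[OF xX] aN this] show ?thesis by (simp add: f_\<beta>[OF xX] f_a near_def)
  qed
  moreover have "\<beta> n y < \<beta> n x \<or> N n \<le> Suc (\<beta> n x)"
    using near1 vN unfolding near_def by linarith
  ultimately show ?thesis using that[OF x 3] by blast
qed

text \<open>The orbit is found backwards in time: an orbit ending in the preimage \<open>x\<close>,
  which is closer to the top, is extended by \<open>y\<close>.\<close>

lemma drift_orbit:
  assumes "y \<in> X" "even n" "a (Suc n) < \<beta> (Suc n) y" "\<beta> (Suc n) y < b (Suc n)" "b n < \<beta> n y"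
  shows "\<exists>m z. z m = y \<and> N n \<le> Suc (\<beta> n (z 0)) \<and> (\<forall>i\<le>m. z i \<in> X) \<and>
    (\<forall>i<m. \<Sigma> (z i) (z (Suc i)) \<and> near 3 (\<beta> n (z i)) (\<beta> n (z (Suc i))))"
  using assms
proof (induction "N n - \<beta> n y" arbitrary: y rule: less_induct)
  case less
  obtain x where x: "\<Sigma> x y" "near 3 (\<beta> n x) (\<beta> n y)"
    "N n \<le> Suc (\<beta> n x) \<or> \<beta> n y < \<beta> n x \<and> a (Suc n) < \<beta> (Suc n) x \<and> \<beta> (Suc n) x < b (Suc n)"
    using drift_step[OF less.prems] by blast
  have xX: "x \<in> X" using x by (simp add: \<Sigma>_def)
  have "\<exists>m z. z m = x \<and> N n \<le> Suc (\<beta> n (z 0)) \<and> (\<forall>i\<le>m. z i \<in> X) \<and>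
    (\<forall>i<m. \<Sigma> (z i) (z (Suc i)) \<and> near 3 (\<beta> n (z i)) (\<beta> n (z (Suc i))))"
  proof (cases "N n \<le> Suc (\<beta> n x)")
    case True
    then show ?thesis using xX by (intro exI[of _ 0] exI[of _ "\<lambda>_. x"]) simp
  next
    case False
    then have *: "\<beta> n y < \<beta> n x" "a (Suc n) < \<beta> (Suc n) x" "\<beta> (Suc n) x < b (Suc n)"
      using x(3) by auto
    show ?thesis
      by (rule less.hyps) (use * False less.prems xX in auto)
  qed
  then obtain m z where z: "z m = x" "N n \<le> Suc (\<beta> n (z 0))" "\<forall>i\<le>m. z i \<in> X"
    "\<forall>i<m. \<Sigma> (z i) (z (Suc i)) \<and> near 3 (\<beta> n (z i)) (\<beta> n (z (Suc i)))" by blast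
  define z' where "z' i = (if i \<le> m then z i else y)" for i
  have "\<Sigma> (z' i) (z' (Suc i)) \<and> near 3 (\<beta> n (z' i)) (\<beta> n (z' (Suc i)))" if "i < Suc m" for i
    using that z(1,4) x(1,2) by (cases "i = m") (auto simp: z'_def)
  moreover have "z' (Suc m) = y" "N n \<le> Suc (\<beta> n (z' 0))" "\<forall>i\<le>Suc m. z' i \<in> X"
    using z less.prems(1) by (auto simp: z'_def)
  ultimately show ?case by blast
qed

text \<open>A displacement of at most \<open>3\<close> at level \<open>n\<close> is adjacency at all
  lower levels, which is the slowness. Two consecutive indices near the bottom are recorded because
  one of them is even, as needed for double steps.\<close>

lemma slow_orbit:
  assumes "even n" "0 < n"
  obtains m z where "0 < m" "9 \<le> \<beta> 0 (z 0)" "\<And>i. i \<in> {m - 1, m} \<Longrightarrow> \<beta> 0 (z i) \<le> 2"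
    "\<And>i. i \<le> m \<Longrightarrow> z i \<in> X"
    "\<And>i. i < m \<Longrightarrow> \<Sigma> (z i) (z (Suc i))"
    "\<And>i j. i < m \<Longrightarrow> j < n \<Longrightarrow> near 1 (\<beta> j (z i)) (\<beta> j (z (Suc i)))"
proof -
  have w: "walk (N (Suc n)) (f n)" by (rule contracting_walk[OF f_contracting])
  \<comment> \<open>A vertex one above the bottom value; it is interior to the segment since both
    end points have other values.\<close>
  obtain c where c: "a (Suc n) \<le> c" "c \<le> b (Suc n)" "f n c = Suc (b n)"
    using walk_attains[OF w ab bN, of "Suc (b n)"] f_a[of n] f_b[of n] gap[of n] by auto
  have c': "a (Suc n) < c" "c < b (Suc n)"
    using c f_a[of n] f_b[of n] gap[of n] by (auto simp: order_less_le)
  obtain y where y: "y \<in> X" "\<beta> (Suc n) y = c" using \<beta>_onto[of c "Suc n"] c(2) bN[of n] by auto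
  have yn: "\<beta> n y = Suc (b n)" using f_\<beta>[OF y(1), of n] y(2) c(3) by simp
  obtain m z where z: "z m = y" "N n \<le> Suc (\<beta> n (z 0))" "\<forall>i\<le>m. z i \<in> X"
    "\<forall>i<m. \<Sigma> (z i) (z (Suc i)) \<and> near 3 (\<beta> n (z i)) (\<beta> n (z (Suc i)))"
    using drift_orbit[OF y(1) assms(1)] y(2) c' yn by auto
  have near_z: "near 1 (\<beta> j (z i)) (\<beta> j (z (Suc i)))" if "i < m" "j < n" for i j
  proof -
    have zX: "z i \<in> X" "z (Suc i) \<in> X" using z(3) that by auto
    obtain n' where n': "n = Suc n'" using assms(2) gr0_implies_Suc by blast
    have "near 5 (\<beta> n (z i)) (\<beta> n (z (Suc i)))" using z(4) that(1) near_mono[of 3 _ _ 5] by simp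
    then have "near 1 (\<beta> n' (z i)) (\<beta> n' (z (Suc i)))" using \<beta>_contract[OF zX] n' by simp
    then show ?thesis using \<beta>_near_mono[OF zX] that(2) n' by simp
  qed
  \<comment> \<open>Auxiliary points over \<open>b n\<close> and, below, over \<open>N n\<close>
    carry the positions of the two ends of the orbit down to level 0.\<close>
  obtain q where q: "q \<in> X" "\<beta> n q = b n" using \<beta>_onto[of "b n" n] gap[of n] by auto
  have "near 1 (\<beta> n y) (\<beta> n q)" using yn q by (simp add: near_def)
  from \<beta>_near_mono[OF y(1) q(1) this, of 0] have lo: "\<beta> 0 (z m) \<le> 1"
    using \<beta>_b[OF q] z(1) by (simp add: near_def)
  obtain q' where q': "q' \<in> X" "\<beta> n q' = N n" using \<beta>_onto[of "N n" n] by auto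
  have z0: "z 0 \<in> X" using z(3) by simp
  have "near 1 (\<beta> n (z 0)) (\<beta> n q')" using z(2) q' \<beta>_le[OF z0, of n] by (simp add: near_def)
  from \<beta>_near_mono[OF z0 q'(1) this, of 0] have hi: "9 \<le> \<beta> 0 (z 0)"
    using \<beta>_N[OF q'] by (simp add: near_def)
  have m: "0 < m" using lo hi by (cases "m = 0") auto
  have "near 1 (\<beta> 0 (z (m - 1))) (\<beta> 0 (z (Suc (m - 1))))"
    by (rule near_z) (use m assms in auto)
  then have "\<beta> 0 (z (m - 1)) \<le> 2" using lo m by (simp add: near_def)
  with lo hi m near_z z(3,4) show ?thesis by (intro that[of m z]) auto
qed

end

section \<open>Conjugacy and the contradiction\<close>

lemma Homeo_mult:
  assumes "f \<in> carrier (Homeo Y)" "g \<in> carrier (Homeo Y)" "c \<in> topspace Y"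
  shows "(f \<otimes>\<^bsub>Homeo Y\<^esub> g) c = f (g c)"
proof -
  have "f \<in> Bij (topspace Y)" "g \<in> Bij (topspace Y)"
    using subgroup.subset[OF subgroup_Homeo, of Y] assms by (auto simp: BijGroup_def)
  then show ?thesis using assms(3) by (simp add: Homeo_def BijGroup_def compose_def)
qed

text \<open>Cancelling the inverse turns conjugacy into an intertwining relation between
  points.\<close>

lemma conjugate_Homeo:
  assumes "conjugate (Homeo Y) \<sigma> \<tau>" "\<tau> \<in> carrier (Homeo Y)"
  obtains h where "h \<in> carrier (Homeo Y)" "\<And>c. c \<in> topspace Y \<Longrightarrow> \<sigma> (h c) = h (\<tau> c)"
proof -
  interpret group "Homeo Y" by (rule group_Homeo)
  obtain h where h: "h \<in> carrier (Homeo Y)"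
    "\<sigma> = h \<otimes>\<^bsub>Homeo Y\<^esub> \<tau> \<otimes>\<^bsub>Homeo Y\<^esub> inv\<^bsub>Homeo Y\<^esub> h"
    using assms(1) unfolding conjugate_def by blast
  have \<sigma>: "\<sigma> \<in> carrier (Homeo Y)" using h assms(2) by simp
  have eq: "\<sigma> \<otimes>\<^bsub>Homeo Y\<^esub> h = h \<otimes>\<^bsub>Homeo Y\<^esub> \<tau>"
    using h(1) assms(2) by (simp add: h(2) m_assoc)
  have "\<sigma> (h c) = h (\<tau> c)" if "c \<in> topspace Y" for c
    using fun_cong[OF eq, of c] Homeo_mult[OF \<sigma> h(1) that] Homeo_mult[OF h(1) assms(2) that] by simp
  with h(1) show ?thesis using that by blast
qed

context tower
begin

lemma continuous_map_conv:
  assumes T: "continuous_map (inv_limit_topology A p) (inv_limit_topology A p) T"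
    and u: "\<And>i. u i \<in> X" "x \<in> X" "conv u x"
  shows "conv (\<lambda>i. T (u i)) (T x)"
  unfolding conv_def
proof
  fix n
  let ?Y = "inv_limit_topology A p"
  have Tx: "T x \<in> X" using continuous_map_image_subset_topspace[OF T] u(2) topspace_limit by blast
  define V where "V = {y \<in> X. \<beta> n y = \<beta> n (T x)}"
  have "openin ?Y V" unfolding openin_limit V_def by (auto intro!: exI[of _ n])
  then have "openin ?Y {y \<in> topspace ?Y. T y \<in> V}" by (rule openin_continuous_map_preimage[OF T])
  moreover have "x \<in> {y \<in> topspace ?Y. T y \<in> V}" using u(2) Tx by (simp add: topspace_limit V_def)
  ultimately obtain m where m: "\<forall>y\<in>X. \<beta> m y = \<beta> m x \<longrightarrow> y \<in> {y \<in> topspace ?Y. T y \<in> V}"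
    unfolding openin_limit by blast
  have "\<forall>\<^sub>F i in sequentially. \<beta> m (u i) = \<beta> m x" using u(3) by (simp add: conv_def)
  then show "\<forall>\<^sub>F i in sequentially. \<beta> n (T (u i)) = \<beta> n (T x)"
  proof (rule eventually_mono)
    fix i assume "\<beta> m (u i) = \<beta> m x"
    with m u(1)[of i] have "T (u i) \<in> V" by simp
    then show "\<beta> n (T (u i)) = \<beta> n (T x)" by (simp add: V_def)
  qed
qed

text \<open>A clopen set separating the preimages of the two ends of the slow orbits is left by \<open>T \<circ> T\<close>
  somewhere along each of these orbits, hence also at a limit point, which lies over a fixed point.\<close>

lemma not_conjugate_to_lift:
  assumes \<sigma>: "\<And>x y. \<Sigma> x y \<Longrightarrow> \<sigma> (pr' x) = pr' y"
    and \<tau>: "\<And>x. x \<in> X \<Longrightarrow> \<tau> (pr' x) = pr' (T x)"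
    and T: "homeomorphic_map (inv_limit_topology A p) (inv_limit_topology A p) T"
    and h: "homeomorphic_map (pseudoarc A p) (pseudoarc A p) h"
    and conj: "\<And>c. c \<in> pr' ` X \<Longrightarrow> \<sigma> (h c) = h (\<tau> c)"
  shows False
proof -
  let ?Y = "inv_limit_topology A p"
  have T_cont: "continuous_map ?Y ?Y T" using T homeomorphic_imp_continuous_map by blast
  have TX: "T ` X = X" using homeomorphic_imp_surjective_map[OF T] by (simp add: topspace_limit)
  have T_X: "T x \<in> X" if "x \<in> X" for x using TX that by blast
  have T_inj: "inj_on T X" using homeomorphic_imp_injective_map[OF T] by (simp add: topspace_limit)
  have h_cont: "continuous_map (pseudoarc A p) (pseudoarc A p) h"
    using h homeomorphic_imp_continuous_map by blast
  have h_onto: "h ` pr' ` X = pr' ` X"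
    using homeomorphic_imp_surjective_map[OF h] by (simp add: topspace_pseudoarc)
  have h_inj: "inj_on h (pr' ` X)"
    using homeomorphic_imp_injective_map[OF h] by (simp add: topspace_pseudoarc)
  \<comment> \<open>The graph of \<open>h\<close> lifted to the limit, where clopen sets are
    available; points over one class share their partners.\<close>
  define H where "H x y \<longleftrightarrow> x \<in> X \<and> y \<in> X \<and> h (pr' x) = pr' y" for x y
  have H_closed: "H x y" if "\<And>i. H (u i) (v i)" "x \<in> X" "y \<in> X" "conv u x" "conv v y" for u v x y
    unfolding H_def
    using continuous_map_closed_graph[OF h_cont, of u x v y] that by (auto simp: H_def)
  have H_step: "H (T x) y'" if "H x y" "\<Sigma> y y'" for x y y'
  proof -
    have X: "x \<in> X" "y \<in> X" "y' \<in> X" "h (pr' x) = pr' y" using that by (auto simp: H_def \<Sigma>_def)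
    have "h (pr' (T x)) = \<sigma> (h (pr' x))" using conj[of "pr' x"] \<tau>[OF X(1)] X(1) by simp
    also have "\<dots> = pr' y'" using \<sigma>[OF that(2)] X(4) by simp
    finally show ?thesis using X T_X by (simp add: H_def)
  qed
  \<comment> \<open>The two preimages are disjoint, since \<open>R\<close> cannot bridge the gap
    between \<open>2\<close> and \<open>9\<close>. By compactness a single level separates
    them.\<close>
  have "\<exists>n. \<forall>x y c d. H x c \<and> 9 \<le> \<beta> 0 c \<and> H y d \<and> \<beta> 0 d \<le> 2 \<longrightarrow> \<beta> n x \<noteq> \<beta> n y"
  proof (rule ccontr)
    assume "\<not> ?thesis"
    then have "\<forall>n. \<exists>x y c d. H x c \<and> 9 \<le> \<beta> 0 c \<and> H y d \<and> \<beta> 0 d \<le> 2 \<and> \<beta> n x = \<beta> n y" by blast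
    then obtain x y c d where *: "\<And>n. H (x n) (c n)" "\<And>n. 9 \<le> \<beta> 0 (c n)" "\<And>n. H (y n) (d n)"
      "\<And>n. \<beta> 0 (d n) \<le> 2" "\<And>n. \<beta> n (x n) = \<beta> n (y n)" by metis
    have X: "\<And>n. x n \<in> X" "\<And>n. c n \<in> X" "\<And>n. y n \<in> X" "\<And>n. d n \<in> X"
      using *(1,3) by (auto simp: H_def)
    obtain x0 c0 d0 s where s: "x0 \<in> X" "c0 \<in> X" "d0 \<in> X" "strict_mono s"
      "conv (\<lambda>i. x (s i)) x0" "conv (\<lambda>i. c (s i)) c0" "conv (\<lambda>i. d (s i)) d0"
      using conv_compact3[of x c d] X by blast
    have "conv (\<lambda>i. y (s i)) x0" unfolding conv_def
    proof
      fix n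
      have "\<forall>\<^sub>F i in sequentially. \<beta> n (x (s i)) = \<beta> n x0 \<and> n \<le> i"
        using s(5) unfolding conv_def by (intro eventually_conj eventually_ge_at_top) auto
      then show "\<forall>\<^sub>F i in sequentially. \<beta> n (y (s i)) = \<beta> n x0"
      proof (rule eventually_mono)
        fix i assume i: "\<beta> n (x (s i)) = \<beta> n x0 \<and> n \<le> i"
        then have "n \<le> s i" using seq_suble[OF s(4), of i] by simp
        then show "\<beta> n (y (s i)) = \<beta> n x0" using \<beta>_eq_mono[OF X(1,3) *(5)] i by metis
      qed
    qed
    then have "H x0 c0" "H x0 d0" using H_closed[OF *(1)] H_closed[OF *(3)] s by blast+
    then have "R c0 d0" using pr_eq_iff by (auto simp: H_def)
    then have "near 1 (\<beta> 0 c0) (\<beta> 0 d0)" by (simp add: R_def)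
    moreover obtain i where "\<beta> 0 (c (s i)) = \<beta> 0 c0" "\<beta> 0 (d (s i)) = \<beta> 0 d0"
      using conv_at[OF s(6,7), of 0 0 0] by blast
    ultimately show False using *(2,4)[of "s i"] by (simp add: near_def)
  qed
  then obtain n0 where n0: "\<And>x y c d. H x c \<Longrightarrow> 9 \<le> \<beta> 0 c \<Longrightarrow> H y d \<Longrightarrow> \<beta> 0 d \<le> 2 \<Longrightarrow> \<beta> n0 x \<noteq> \<beta> n0 y"
    by blast
  \<comment> \<open>The clopen set consists of the \<open>n0\<close>-fibres that meet the preimage
    of the upper end.\<close>
  define K where "K v \<longleftrightarrow> (\<exists>x c. H x c \<and> 9 \<le> \<beta> 0 c \<and> \<beta> n0 x = v)" for v
  have "\<exists>u v v'. H u v \<and> \<Sigma> v v' \<and> K (\<beta> n0 u) \<and> \<not> K (\<beta> n0 (T (T u))) \<and>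
    (\<forall>j\<le>i. near 1 (\<beta> j v) (\<beta> j v'))" for i
  proof -
    define n where "n = 2 * i + 2"
    have n: "even n" "0 < n" "i < n" by (auto simp: n_def)
    obtain m z where z: "0 < m" "9 \<le> \<beta> 0 (z 0)" "\<And>i. i \<in> {m - 1, m} \<Longrightarrow> \<beta> 0 (z i) \<le> 2"
      "\<And>i. i \<le> m \<Longrightarrow> z i \<in> X"
      "\<And>i. i < m \<Longrightarrow> \<Sigma> (z i) (z (Suc i))"
      "\<And>i j. i < m \<Longrightarrow> j < n \<Longrightarrow> near 1 (\<beta> j (z i)) (\<beta> j (z (Suc i)))"
      using slow_orbit[OF n(1,2)] by metis
    have z0: "z 0 \<in> X" by (rule z(4)) simp
    then have "pr' (z 0) \<in> h ` pr' ` X" unfolding h_onto by (rule imageI)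
    then obtain w0 where "w0 \<in> X" "pr' (z 0) = h (pr' w0)" by auto
    then have w0: "H w0 (z 0)" using z0 by (simp add: H_def)
    define w where "w i = (T ^^ i) w0" for i
    have w_Suc: "w (Suc i) = T (w i)" for i by (simp add: w_def)
    have Hw: "H (w i) (z i)" if "i \<le> m" for i using that
    proof (induction i)
      case 0
      then show ?case using w0 by (simp add: w_def)
    next
      case (Suc i)
      then show ?case using H_step[of "w i" "z i" "z (Suc i)"] z(5)[of i] by (simp add: w_Suc)
    qed
    \<comment> \<open>\<open>2 * m'\<close> is the even one among the last two indices, so double
      steps of \<open>T\<close> lead there from the start.\<close>
    define m' where "m' = m div 2"
    have m': "2 * m' \<le> m" "2 * m' \<in> {m - 1, m}" by (auto simp: m'_def)
    have K0: "K (\<beta> n0 (w (2 * 0)))" using Hw[of 0] z(2) unfolding K_def by auto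
    have Km: "\<not> K (\<beta> n0 (w (2 * m')))"
      using n0[OF _ _ Hw[OF m'(1)] z(3)[OF m'(2)]] unfolding K_def by blast
    \<comment> \<open>A double step at which the orbit leaves the clopen set.\<close>
    obtain q where q: "q < m'" "K (\<beta> n0 (w (2 * q)))" "\<not> K (\<beta> n0 (w (2 * Suc q)))"
      using last_before[of "\<lambda>q. K (\<beta> n0 (w (2 * q)))" 0 m'] K0 Km by blast
    have qm: "2 * q < m" using q(1) m'(1) by simp
    have "H (w (2 * q)) (z (2 * q))" "\<Sigma> (z (2 * q)) (z (Suc (2 * q)))"
      using Hw[of "2 * q"] z(5)[OF qm] qm by simp_all
    moreover have "\<not> K (\<beta> n0 (T (T (w (2 * q)))))" using q(3) by (simp add: w_Suc)
    moreover have "near 1 (\<beta> j (z (2 * q))) (\<beta> j (z (Suc (2 * q))))" if "j \<le> i" for j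
      by (rule z(6)[OF qm]) (use that n in simp)
    ultimately show ?thesis using q(2) by blast
  qed
  then have "\<forall>i. \<exists>u v v'. H u v \<and> \<Sigma> v v' \<and> K (\<beta> n0 u) \<and> \<not> K (\<beta> n0 (T (T u))) \<and>
    (\<forall>j\<le>i. near 1 (\<beta> j v) (\<beta> j v'))" by blast
  then obtain u v v' where uv: "\<And>i. H (u i) (v i)" "\<And>i. \<Sigma> (v i) (v' i)" "\<And>i. K (\<beta> n0 (u i))"
    "\<And>i. \<not> K (\<beta> n0 (T (T (u i))))" "\<And>i j. j \<le> i \<Longrightarrow> near 1 (\<beta> j (v i)) (\<beta> j (v' i))"
    by metis
  have X: "u i \<in> X" "v i \<in> X" "v' i \<in> X" for i using uv(1,2) by (auto simp: H_def \<Sigma>_def)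
  obtain x y y' s where s: "x \<in> X" "y \<in> X" "y' \<in> X" "strict_mono s"
    "conv (\<lambda>i. u (s i)) x" "conv (\<lambda>i. v (s i)) y" "conv (\<lambda>i. v' (s i)) y'"
    using conv_compact3[of u v v'] X by blast
  have Hxy: "H x y" using H_closed[OF uv(1)] s by blast
  have Syy: "\<Sigma> y y'" using \<Sigma>_closed[OF uv(2)] s by blast
  have "near 1 (\<beta> n y) (\<beta> n y')" for n
  proof -
    obtain i where i: "n \<le> i" "\<beta> n (v (s i)) = \<beta> n y" "\<beta> n (v' (s i)) = \<beta> n y'"
      using conv_at[OF s(6,7), of n n n] by blast
    have "n \<le> s i" using i(1) seq_suble[OF s(4), of i] by simp
    from uv(5)[OF this] show ?thesis using i by simp
  qed
  \<comment> \<open>The orbits become slower with \<open>i\<close>, so the limit point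
    \<open>y\<close> lies over a fixed point of \<open>\<sigma>\<close>.\<close>
  then have yy: "pr' y = pr' y'" using pr_eq_iff s by (simp add: R_def)
  have "H (T x) y'" by (rule H_step[OF Hxy Syy])
  then have "h (pr' (T x)) = h (pr' x)" using Hxy yy by (simp add: H_def)
  then have "pr' (T x) = pr' x" using h_inj s(1) T_X by (simp add: inj_on_eq_iff)
  then have "pr' (T (T x)) = pr' (T x)" using \<tau>[OF s(1)] \<tau>[OF T_X[OF s(1)]] by simp
  \<comment> \<open>The points \<open>x\<close>, \<open>T x\<close> and \<open>T (T x)\<close> lie
    in one class of at most two points. By injectivity of \<open>T\<close>, each possible
    coincidence gives \<open>T (T x) = x\<close>.\<close>
  then have "R x (T x)" "R (T x) (T (T x))" "R x (T (T x))"
    using \<open>pr' (T x) = pr' x\<close> pr_eq_iff T_X s(1) by metis+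
  then have "x = T x \<or> T x = T (T x) \<or> x = T (T x)"
    using R_class_le2 s(1) T_X by blast
  then have TT: "T (T x) = x"
    using T_inj s(1) T_X by (metis inj_onD)
  have cTT: "conv (\<lambda>i. T (T (u (s i)))) (T (T x))"
    using continuous_map_conv[OF T_cont] s(1,5) X(1) T_X by simp
  \<comment> \<open>For such \<open>i\<close> both \<open>u (s i)\<close> and its image under the
    double step lie in the \<open>n0\<close>-fibre of \<open>x\<close>, yet \<open>K\<close>
    distinguishes them.\<close>
  obtain i where "\<beta> n0 (u (s i)) = \<beta> n0 x" "\<beta> n0 (T (T (u (s i)))) = \<beta> n0 (T (T x))"
    using conv_at[OF s(5) cTT, of 0 n0 n0] by blast
  then show False using uv(3,4)[of "s i"] TT by simp
qed

lemma ex_not_conjugate: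
  "\<exists>\<sigma> \<in> carrier (Homeo (pseudoarc A p)).
     \<forall>\<tau> \<in> pr_Aut A p. \<not> conjugate (Homeo (pseudoarc A p)) \<sigma> \<tau>"
proof -
  obtain \<sigma> where \<sigma>: "\<sigma> \<in> carrier (Homeo (pseudoarc A p))" "\<And>x y. \<Sigma> x y \<Longrightarrow> \<sigma> (pr' x) = pr' y"
    by (rule closed_relation_Homeo[of \<Sigma>, OF _ \<Sigma>_total_right \<Sigma>_total_left \<Sigma>_closed \<Sigma>_compat])
      (auto simp: \<Sigma>_def)
  have False if \<tau>: "\<tau> \<in> pr_Aut A p" and c: "conjugate (Homeo (pseudoarc A p)) \<sigma> \<tau>" for \<tau>
  proof -
    have \<tau>': "\<tau> \<in> carrier (Homeo (pseudoarc A p))" using \<tau> by (simp add: pr_Aut_def)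
    obtain T where T: "T \<in> Aut A p" "\<forall>x\<in>X. \<tau> (pr' x) = pr' (T x)"
      using \<tau> by (auto simp: pr_Aut_def)
    obtain h where h: "h \<in> carrier (Homeo (pseudoarc A p))"
      "\<And>c. c \<in> topspace (pseudoarc A p) \<Longrightarrow> \<sigma> (h c) = h (\<tau> c)"
      using conjugate_Homeo[OF c \<tau>'] by metis
    show False
      by (rule not_conjugate_to_lift[of \<sigma> \<tau> T h])
        (use \<sigma>(2) T h in \<open>auto simp: Aut_def Homeo_def topspace_pseudoarc\<close>)
  qed
  with \<sigma>(1) show ?thesis by blast
qed

end

theorem theorem5p1:
  fixes A :: "nat \<Rightarrow> nat graph" and p :: "nat \<Rightarrow> nat \<Rightarrow> nat"
  assumes "generic_sequence A p"
  shows "\<exists>\<sigma> \<in> carrier (Homeo (pseudoarc A p)).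
           \<forall>\<tau> \<in> pr_Aut A p. \<not> conjugate (Homeo (pseudoarc A p)) \<sigma> \<tau>"
proof -
  obtain l N a b r f g k where "tower A p l N a b r f g k" using generic_tower[OF assms] by blast
  then show ?thesis by (rule tower.ex_not_conjugate)
qed

end
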